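(* Let $d\geq 1$, let $G$ be a finite $d$--regular bipartite graph, and let $t\geq0$. Then $$\int\frac12\ln(1+tz^2)\,d\rho_G(z)\geq\int\frac12\ln(1+tz^2)\,d\rho_{\mathbb{T}_d}(z).$$
   Context: For a finite graph $G$ with $m_k(G)$ matchings of size $k$, the matching polynomial is $\mu(G,x)=\sum_k(-1)^km_k(G)x^{v(G)-2k}$, and the matching measure $\rho_G=\frac{1}{v(G)}\sum_{z:\mu(G,z)=0}\delta_z$ (zeros counted with multiplicity). $\rho_{\mathbb{T}_d}$ denotes the weak limit of $\rho_{G_i}$ for any sequence $(G_i)$ of finite $d$--regular graphs whose girth tends to infinity (this limit exists and does not depend on the sequence). *)

theory Defs
  imports "HOL-Probability.Probability" "HOL-Computational_Algebra.Polynomial"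
begin

definition fin_graph :: "'a set \<Rightarrow> ('a \<Rightarrow> 'a \<Rightarrow> bool) \<Rightarrow> bool" where
  "fin_graph V E \<longleftrightarrow> finite V \<and> (\<forall>u v. E u v \<longrightarrow> u \<in> V \<and> v \<in> V)
     \<and> (\<forall>u v. E u v \<longrightarrow> E v u) \<and> (\<forall>v. \<not> E v v)"

definition regular :: "nat \<Rightarrow> 'a set \<Rightarrow> ('a \<Rightarrow> 'a \<Rightarrow> bool) \<Rightarrow> bool" where
  "regular d V E \<longleftrightarrow> (\<forall>v\<in>V. card {u\<in>V. E v u} = d)"

definition bipartite :: "'a set \<Rightarrow> ('a \<Rightarrow> 'a \<Rightarrow> bool) \<Rightarrow> bool" where
  "bipartite V E \<longleftrightarrow> (\<exists>A\<subseteq>V. \<forall>u v. E u v \<longrightarrow> (u \<in> A \<longleftrightarrow> v \<notin> A))"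

definition has_cycle_of_length :: "'a set \<Rightarrow> ('a \<Rightarrow> 'a \<Rightarrow> bool) \<Rightarrow> nat \<Rightarrow> bool" where
  "has_cycle_of_length V E k \<longleftrightarrow> k \<ge> 3 \<and> (\<exists>vs. length vs = k \<and> distinct vs \<and> set vs \<subseteq> V
      \<and> (\<forall>i<k. E (vs ! i) (vs ! ((i + 1) mod k))))"

definition girth_ge :: "'a set \<Rightarrow> ('a \<Rightarrow> 'a \<Rightarrow> bool) \<Rightarrow> nat \<Rightarrow> bool" where
  "girth_ge V E n \<longleftrightarrow> (\<forall>k<n. \<not> has_cycle_of_length V E k)"

definition edges :: "'a set \<Rightarrow> ('a \<Rightarrow> 'a \<Rightarrow> bool) \<Rightarrow> 'a set set" where
  "edges V E = {{u, v} | u v. u \<in> V \<and> v \<in> V \<and> E u v}"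

definition is_matching :: "'a set \<Rightarrow> ('a \<Rightarrow> 'a \<Rightarrow> bool) \<Rightarrow> 'a set set \<Rightarrow> bool" where
  "is_matching V E M \<longleftrightarrow> M \<subseteq> edges V E \<and> (\<forall>e\<in>M. \<forall>f\<in>M. e \<noteq> f \<longrightarrow> e \<inter> f = {})"

definition num_matchings :: "'a set \<Rightarrow> ('a \<Rightarrow> 'a \<Rightarrow> bool) \<Rightarrow> nat \<Rightarrow> nat" where
  "num_matchings V E k = card {M. is_matching V E M \<and> card M = k}"

definition matching_poly :: "'a set \<Rightarrow> ('a \<Rightarrow> 'a \<Rightarrow> bool) \<Rightarrow> real poly" where
  "matching_poly V E = (\<Sum>k\<le>card V div 2.
      monom ((-1) ^ k * real (num_matchings V E k)) (card V - 2 * k))"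

text \<open>Matching measure: (1/v(G)) times the sum of Dirac masses at the zeros of mu(G,x),
  counted with multiplicity. (All zeros are real by Heilmann--Lieb; the measure is on the
  real line with its Borel sets.)\<close>
definition matching_measure :: "'a set \<Rightarrow> ('a \<Rightarrow> 'a \<Rightarrow> bool) \<Rightarrow> real measure" where
  "matching_measure V E =
     distr (density (count_space UNIV)
              (\<lambda>z. ennreal (real (order z (matching_poly V E)) / real (card V))))
           borel (\<lambda>z. z)"

definition bounded_continuous_fun :: "(real \<Rightarrow> real) \<Rightarrow> bool" where
  "bounded_continuous_fun f \<longleftrightarrow> continuous_on UNIV f \<and> bounded (range f)"

definition weak_converges :: "(nat \<Rightarrow> real measure) \<Rightarrow> real measure \<Rightarrow> bool" where
  "weak_converges Ms M \<longleftrightarrow> (\<forall>f. bounded_continuous_fun f \<longrightarrow>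
      (\<lambda>i. \<integral>z. f z \<partial>Ms i) \<longlonglongrightarrow> (\<integral>z. f z \<partial>M))"

text \<open>Sequences of finite nonempty d-regular graphs whose girth tends to infinity
  (vertices taken from nat, which is no restriction for finite graphs).\<close>
definition large_girth_seq :: "nat \<Rightarrow> (nat \<Rightarrow> nat set) \<Rightarrow> (nat \<Rightarrow> nat \<Rightarrow> nat \<Rightarrow> bool) \<Rightarrow> bool" where
  "large_girth_seq d Vs Es \<longleftrightarrow>
     (\<forall>i. fin_graph (Vs i) (Es i) \<and> Vs i \<noteq> {} \<and> regular d (Vs i) (Es i))
     \<and> (\<forall>n. eventually (\<lambda>i. girth_ge (Vs i) (Es i) n) sequentially)"

definition rho_tree :: "nat \<Rightarrow> real measure" where
  "rho_tree d = (THE M. sets M = sets borel \<and> prob_space M \<and>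
      (\<forall>Vs Es. large_girth_seq d Vs Es \<longrightarrow>
          weak_converges (\<lambda>i. matching_measure (Vs i) (Es i)) M))"

end

(*
  Two facts are combined. First, if H is a 2-cover of a bipartite graph G, then the matching generating
  functions satisfy M(H,t) <= M(G,t)^2: a matching of H is sent to the trivial cover G + G by properly
  2-colouring the edges of its projection, which is possible since G is bipartite. Hence
  ln M(G,t) / v(G), which is the integral of ln(1 + t z^2) / 2 against the matching measure, does not
  increase under 2-covers, and iterated 2-covers reach arbitrarily large girth. Second, the ratios
  mu(G-u,x) / mu(G,x) satisfy a recursion along self-avoiding walks that contracts for large x, so the
  average resolvent of the zeros, and with it the integral of any continuous function, depends only on d
  up to an error that vanishes as the girth grows. Helly's theorem then supplies the limit measure.
*)
theory Submission
  imports Defs "HOL-Computational_Algebra.Fundamental_Theorem_Algebra"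
begin

section \<open>Matchings and the matching polynomial\<close>

text \<open>Matchings of a 2-cover with the same projection must still get different images, which a
  colouring alone does not achieve. Components of the projection are paths, even cycles and doubled
  edges; each has at most two lifts, because a chosen edge upstairs leaves only one of the two lifts
  of each end for the next edge. Each also has two proper colourings. So one reference matching with
  one colouring is fixed per projection, and the colours are swapped on the components where the
  given matching departs from the reference. Bipartiteness excludes odd cycles, which have no proper
  2-colouring. The threshold \<open>2 * d + 2\<close> is generous: beyond it the ratios are at most
  \<open>1 / (d + 2)\<close> and one step of the recursion halves errors. Resolvents at real points
  beyond it are enough, since powers of \<open>z\<close> come back from their behaviour at infinity
  and Stone-Weierstrass does the rest. The covers serve a second purpose: \<open>rho_tree\<close> is
  a definite description, which singles out a measure only because \<open>d\<close>-regular graphs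
  of arbitrarily large girth exist, and the covers of \<open>G\<close> provide them.\<close>

text \<open>Unlike \<open>fin_graph\<close>, this does not tie \<open>E\<close> to a vertex set, so
  it survives when vertices are deleted from \<open>W\<close> while \<open>E\<close> stays
  fixed.\<close>

definition simple_rel :: "('a \<Rightarrow> 'a \<Rightarrow> bool) \<Rightarrow> bool" where
  "simple_rel E \<longleftrightarrow> (\<forall>u v. E u v \<longrightarrow> E v u) \<and> (\<forall>v. \<not> E v v)"

text \<open>The matching polynomial of the subgraph induced on \<open>W\<close>, evaluated in any
  commutative ring: complex points give real-rootedness, real points the ratio estimates. For finite
  \<open>W\<close> and simple \<open>E\<close> the exponent never truncates, by
  \<open>card_matching_le\<close>.\<close>

definition matching_sum :: "'a set \<Rightarrow> ('a \<Rightarrow> 'a \<Rightarrow> bool) \<Rightarrow> 'b::comm_ring_1 \<Rightarrow> 'b" where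
  "matching_sum W E x = (\<Sum>M | is_matching W E M. (-1) ^ card M * x ^ (card W - 2 * card M))"

lemma fin_graph_simple: "fin_graph V E \<Longrightarrow> simple_rel E"
  by (simp add: fin_graph_def simple_rel_def)

lemma fin_graph_finite: "fin_graph V E \<Longrightarrow> finite V"
  by (simp add: fin_graph_def)

lemma simple_rel_sym: "simple_rel E \<Longrightarrow> E u v \<Longrightarrow> E v u"
  by (simp add: simple_rel_def)

lemma simple_rel_irrefl: "simple_rel E \<Longrightarrow> E u v \<Longrightarrow> u \<noteq> v"
  by (auto simp: simple_rel_def)

lemma edges_subset_Pow: "edges W E \<subseteq> Pow W"
  by (auto simp: edges_def)

lemma finite_edges: "finite W \<Longrightarrow> finite (edges W E)"
  by (rule finite_subset[OF edges_subset_Pow]) simp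

lemma card_edge: "simple_rel E \<Longrightarrow> e \<in> edges W E \<Longrightarrow> card e = 2"
  by (auto simp: edges_def card_insert_if dest: simple_rel_irrefl)

lemma edgeE:
  assumes "simple_rel E" "e \<in> edges W E" "v \<in> e"
  obtains w where "e = {v, w}" "v \<in> W" "w \<in> W" "E v w" "w \<noteq> v"
proof -
  from assms(2) obtain a b where ab: "e = {a, b}" "a \<in> W" "b \<in> W" "E a b" by (auto simp: edges_def)
  have "E b a" "a \<noteq> b" using ab assms(1) by (auto simp: simple_rel_def)
  with ab assms(3) that show ?thesis by (cases "v = a") (auto simp: insert_commute)
qed

lemma matchingD: "is_matching W E M \<Longrightarrow> e \<in> M \<Longrightarrow> f \<in> M \<Longrightarrow> v \<in> e \<Longrightarrow> v \<in> f \<Longrightarrow> e = f"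
  unfolding is_matching_def by blast

lemma finite_matchings: "finite W \<Longrightarrow> finite {M. is_matching W E M}"
  by (rule finite_subset[of _ "Pow (edges W E)"]) (auto simp: is_matching_def finite_edges)

lemma finite_matching: "finite W \<Longrightarrow> is_matching W E M \<Longrightarrow> finite M"
  using finite_edges finite_subset by (auto simp: is_matching_def)

lemma is_matching_empty [simp]: "is_matching W E {}"
  by (simp add: is_matching_def)

lemma card_matched_vertices:
  assumes "finite W" "simple_rel E" "is_matching W E M"
  shows "card (\<Union>M) = 2 * card M"
proof -
  have "card (\<Union>M) = sum card M"
    by (rule card_Union_disjoint)
      (use assms in \<open>auto simp: is_matching_def pairwise_def disjnt_def edges_def\<close>)
  also have "\<dots> = (\<Sum>e\<in>M. 2)"
    using assms by (intro sum.cong refl card_edge) (auto simp: is_matching_def)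
  finally show ?thesis by simp
qed

lemma Union_matching_subset: "is_matching W E M \<Longrightarrow> \<Union>M \<subseteq> W"
  by (auto simp: is_matching_def edges_def)

lemma card_matching_le:
  assumes "finite W" "simple_rel E" "is_matching W E M"
  shows "2 * card M \<le> card W"
  using card_matched_vertices[OF assms] card_mono[OF assms(1) Union_matching_subset[OF assms(3)]]
  by simp

lemma is_matching_remove_iff:
  "is_matching (W - U) E M \<longleftrightarrow> is_matching W E M \<and> \<Union>M \<inter> U = {}"
proof -
  have "edges (W - U) E = {e \<in> edges W E. e \<inter> U = {}}" by (auto simp: edges_def)
  then show ?thesis by (auto simp: is_matching_def)
qed

lemma matchings_at_vertex:
  assumes "simple_rel E" "u \<in> W"
  shows "{M. is_matching W E M \<and> u \<in> \<Union>M} =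
    (\<Union>v\<in>{v\<in>W - {u}. E u v}. insert {u, v} ` {M. is_matching (W - {u, v}) E M})"
proof (intro equalityI subsetI)
  fix M assume "M \<in> {M. is_matching W E M \<and> u \<in> \<Union>M}"
  then obtain e where M: "is_matching W E M" "e \<in> M" "u \<in> e" by auto
  then obtain v where v: "e = {u, v}" "u \<in> W" "v \<in> W" "E u v" "v \<noteq> u"
    using edgeE[OF assms(1), of e W u] by (auto simp: is_matching_def)
  have "is_matching W E (M - {e})" using M(1) by (auto simp: is_matching_def)
  moreover have "\<Union>(M - {e}) \<inter> {u, v} = {}"
    using M v matchingD[OF M(1)] by blast
  ultimately have "is_matching (W - {u, v}) E (M - {e})" by (simp add: is_matching_remove_iff)
  moreover have "M = insert {u, v} (M - {e})" using M v by auto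
  ultimately show "M \<in> (\<Union>v\<in>{v\<in>W - {u}. E u v}. insert {u, v} ` {M. is_matching (W - {u, v}) E M})"
    using v by blast
next
  fix M assume "M \<in> (\<Union>v\<in>{v\<in>W - {u}. E u v}. insert {u, v} ` {M. is_matching (W - {u, v}) E M})"
  then obtain v M' where v: "v \<in> W" "E u v" "M = insert {u, v} M'" "is_matching (W - {u, v}) E M'"
    by auto
  have "is_matching W E M'" "\<Union>M' \<inter> {u, v} = {}" using v(4) by (auto simp: is_matching_remove_iff)
  moreover have "{u, v} \<in> edges W E" using v assms by (auto simp: edges_def)
  moreover have "e \<inter> {u, v} = {}" if "e \<in> M'" for e
    using that \<open>\<Union>M' \<inter> {u, v} = {}\<close> by auto
  ultimately have "is_matching W E M" unfolding v(3) is_matching_def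
    by (simp add: Int_commute)
  then show "M \<in> {M. is_matching W E M \<and> u \<in> \<Union>M}" using v(3) by auto
qed

text \<open>Either \<open>u\<close> is unmatched, or its partner \<open>v\<close> is fixed and the
  rest is a matching of \<open>W - {u, v}\<close> with one edge fewer, which accounts for the
  sign.\<close>

lemma matching_sum_rec:
  assumes fin: "finite W" and E: "simple_rel E" and u: "u \<in> W"
  shows "matching_sum W E x = x * matching_sum (W - {u}) E x
    - (\<Sum>v | v \<in> W - {u} \<and> E u v. matching_sum (W - {u, v}) E x)"
proof -
  let ?g = "\<lambda>M. (-1) ^ card M * x ^ (card W - 2 * card M)"
  let ?N = "{v. v \<in> W - {u} \<and> E u v}"
  have cW: "card W = Suc (card (W - {u}))" using card_Suc_Diff1[OF fin u] by simp
  have split: "{M. is_matching W E M} = {M. is_matching (W - {u}) E M} \<union> {M. is_matching W E M \<and> u \<in> \<Union>M}"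
    by (auto simp: is_matching_remove_iff)
  have "matching_sum W E x = sum ?g {M. is_matching (W - {u}) E M} + sum ?g {M. is_matching W E M \<and> u \<in> \<Union>M}"
    unfolding matching_sum_def split
  proof (rule sum.union_disjoint)
    show "finite {M. is_matching (W - {u}) E M}" using fin by (intro finite_matchings) simp
    show "finite {M. is_matching W E M \<and> u \<in> \<Union>M}"
      by (rule finite_subset[OF _ finite_matchings[OF fin, of E]]) auto
  qed (auto simp: is_matching_remove_iff)
  also have "sum ?g {M. is_matching (W - {u}) E M} = x * matching_sum (W - {u}) E x"
    unfolding matching_sum_def sum_distrib_left
  proof (rule sum.cong[OF refl])
    fix M assume "M \<in> {M. is_matching (W - {u}) E M}"
    then have "2 * card M \<le> card (W - {u})" using card_matching_le[of "W - {u}" E M] fin E by auto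
    then have "card W - 2 * card M = Suc (card (W - {u}) - 2 * card M)" using cW by auto
    then show "?g M = x * ((-1) ^ card M * x ^ (card (W - {u}) - 2 * card M))" by simp
  qed
  also have "sum ?g {M. is_matching W E M \<and> u \<in> \<Union>M}
      = (\<Sum>v\<in>?N. sum ?g (insert {u, v} ` {M. is_matching (W - {u, v}) E M}))"
    unfolding matchings_at_vertex[OF E u]
  proof (rule sum.UNION_disjoint)
    show "\<forall>i\<in>?N. \<forall>j\<in>?N. i \<noteq> j \<longrightarrow> insert {u, i} ` {M. is_matching (W - {u, i}) E M} \<inter>
          insert {u, j} ` {M. is_matching (W - {u, j}) E M} = {}"
    proof (intro ballI impI, rule ccontr)
      fix i j assume ij: "i \<in> ?N" "j \<in> ?N" "i \<noteq> j" and "insert {u, i} ` {M. is_matching (W - {u, i}) E M} \<inter>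
          insert {u, j} ` {M. is_matching (W - {u, j}) E M} \<noteq> {}"
      then obtain M M' where "is_matching (W - {u, i}) E M" "insert {u, i} M = insert {u, j} M'" by auto
      then have "\<Union>M \<inter> {u, i} = {}" and "{u, j} \<in> insert {u, i} M" by (auto simp: is_matching_remove_iff)
      then have "{u, j} = {u, i}" by auto
      then show False using ij by (auto simp: doubleton_eq_iff)
    qed
  qed (use fin in \<open>auto intro: finite_matchings\<close>)
  also have "\<dots> = (\<Sum>v\<in>?N. - matching_sum (W - {u, v}) E x)"
  proof (rule sum.cong[OF refl])
    fix v assume v: "v \<in> ?N"
    have inj: "inj_on (insert {u, v}) {M. is_matching (W - {u, v}) E M}"
    proof (rule inj_onI)
      fix M M' assume M: "M \<in> {M. is_matching (W - {u, v}) E M}" "M' \<in> {M. is_matching (W - {u, v}) E M}"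
        "insert {u, v} M = insert {u, v} M'"
      then have "{u, v} \<notin> M" "{u, v} \<notin> M'" by (auto simp: is_matching_remove_iff)
      then show "M = M'" using M(3) by (metis insert_ident)
    qed
    have "card (insert u (insert v W')) = Suc (Suc (card W'))" if "W' = W - {u, v}" for W'
      using that fin v by (auto simp: card_insert_if)
    moreover have "insert u (insert v (W - {u, v})) = W" using u v by auto
    ultimately have cW2: "card W = Suc (Suc (card (W - {u, v})))" by simp
    have "sum ?g (insert {u, v} ` {M. is_matching (W - {u, v}) E M})
       = (\<Sum>M | is_matching (W - {u, v}) E M. ?g (insert {u, v} M))"
      by (simp add: sum.reindex[OF inj])
    also have "\<dots> = (\<Sum>M | is_matching (W - {u, v}) E M. - ((-1) ^ card M * x ^ (card (W - {u, v}) - 2 * card M)))"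
    proof (rule sum.cong[OF refl])
      fix M assume M: "M \<in> {M. is_matching (W - {u, v}) E M}"
      have "{u, v} \<notin> M" using M by (auto simp: is_matching_remove_iff)
      moreover have "finite M" using M fin finite_matching[of "W - {u, v}" E M] by auto
      ultimately have c: "card (insert {u, v} M) = Suc (card M)" by simp
      have "card W - 2 * Suc (card M) = card (W - {u, v}) - 2 * card M" unfolding cW2 by simp
      then show "?g (insert {u, v} M) = - ((-1) ^ card M * x ^ (card (W - {u, v}) - 2 * card M))" unfolding c by simp
    qed
    finally show "sum ?g (insert {u, v} ` {M. is_matching (W - {u, v}) E M}) = - matching_sum (W - {u, v}) E x"
      by (simp add: matching_sum_def sum_negf)
  qed
  finally show ?thesis by (simp add: sum_negf)
qed

lemma matching_sum_empty [simp]: "matching_sum {} E x = 1"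
proof -
  have "{M. is_matching {} E M} = {{}}" by (auto simp: is_matching_def edges_def)
  then show ?thesis by (simp add: matching_sum_def)
qed

lemma poly_matching_poly:
  assumes "fin_graph V E"
  shows "poly (map_poly of_real (matching_poly V E)) x = (matching_sum V E x :: 'b::{comm_ring_1,real_algebra_1})"
proof -
  have fin: "finite V" and E: "simple_rel E" using assms by (auto simp: fin_graph_finite fin_graph_simple)
  let ?A = "{M. is_matching V E M}" and ?g = "\<lambda>k. (-1) ^ k * x ^ (card V - 2 * k)"
  have "matching_sum V E x = (\<Sum>k\<le>card V div 2. \<Sum>M | M \<in> ?A \<and> card M = k. ?g (card M))"
    unfolding matching_sum_def
  proof (rule sum.group[symmetric])
    show "card ` ?A \<subseteq> {..card V div 2}"
    proof clarify
      fix M assume "is_matching V E M"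
      then show "card M \<le> card V div 2" using card_matching_le[OF fin E, of M] by linarith
    qed
  qed (use finite_matchings[OF fin] in auto)
  also have "\<dots> = (\<Sum>k\<le>card V div 2. of_real ((-1) ^ k * real (num_matchings V E k)) * x ^ (card V - 2 * k))"
    by (intro sum.cong refl) (auto simp: num_matchings_def)
  also have "\<dots> = poly (map_poly of_real (matching_poly V E)) x"
  proof -
    have "(map_poly of_real (matching_poly V E) :: 'b poly) = (\<Sum>k\<le>card V div 2. monom (of_real ((-1) ^ k * real (num_matchings V E k))) (card V - 2 * k))"
      unfolding matching_poly_def by (intro poly_eqI) (simp add: coeff_map_poly coeff_sum if_distrib cong: if_cong)
    then show ?thesis by (simp only: poly_sum poly_monom)
  qed
  finally show ?thesis by simp
qed

section \<open>Zeros of the matching polynomial\<close>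

text \<open>Divided by the value on \<open>W - {u}\<close>, the recursion writes the ratio as
  \<open>x\<close> minus reciprocals of ratios one vertex smaller. Those lie in the upper half-plane
  by induction, inversion moves them to the lower one, and subtracting them can only raise the
  imaginary part. Non-vanishing is carried along to allow the division.\<close>

lemma matching_sum_ratio_Im:
  fixes x :: complex
  assumes "finite W" "simple_rel E" "Im x > 0"
  shows "matching_sum W E x \<noteq> 0 \<and>
    (\<forall>u\<in>W. Im (matching_sum W E x / matching_sum (W - {u}) E x) > 0)"
  using assms(1)
proof (induction "card W" arbitrary: W rule: less_induct)
  case less
  have pos: "Im (matching_sum W E x / matching_sum (W - {u}) E x) > 0" if u: "u \<in> W" for u
  proof -
    have IH: "matching_sum (W - {u}) E x \<noteq> 0"
      "\<And>v. v \<in> W - {u} \<Longrightarrow> Im (matching_sum (W - {u}) E x / matching_sum (W - {u} - {v}) E x) > 0"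
      using less.hyps[OF card_Diff1_less[OF less.prems u]] less.prems by auto
    have "matching_sum W E x / matching_sum (W - {u}) E x
      = x - (\<Sum>v | v \<in> W - {u} \<and> E u v. matching_sum (W - {u, v}) E x / matching_sum (W - {u}) E x)"
      using IH(1) matching_sum_rec[OF less.prems assms(2) u, of x]
      by (simp add: diff_divide_distrib sum_divide_distrib)
    then have "Im (matching_sum W E x / matching_sum (W - {u}) E x)
      = Im x - (\<Sum>v | v \<in> W - {u} \<and> E u v. Im (matching_sum (W - {u, v}) E x / matching_sum (W - {u}) E x))"
      by (simp add: Im_sum)
    moreover have "Im (matching_sum (W - {u, v}) E x / matching_sum (W - {u}) E x) \<le> 0" if "v \<in> W - {u}" for v
    proof -
      let ?w = "matching_sum (W - {u}) E x / matching_sum (W - {u, v}) E x"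
      have "W - {u, v} = W - {u} - {v}" by auto
      then have "Im ?w > 0" using IH(2)[OF that] by simp
      moreover have "Im (inverse w) \<le> 0" if "Im w > 0" for w :: complex
        using that by (simp add: divide_nonpos_nonneg)
      ultimately have "Im (inverse ?w) \<le> 0" by blast
      then show ?thesis by (simp only: inverse_divide)
    qed
    then have "(\<Sum>v | v \<in> W - {u} \<and> E u v. Im (matching_sum (W - {u, v}) E x / matching_sum (W - {u}) E x)) \<le> 0"
      by (intro sum_nonpos) auto
    ultimately show ?thesis using assms(3) by linarith
  qed
  moreover have "matching_sum W E x \<noteq> 0"
  proof (cases "W = {}")
    case False
    then obtain u where "u \<in> W" by auto
    from pos[OF this] show ?thesis by auto
  qed simp
  ultimately show ?case by blast
qed

lemma matching_sum_cnj: "matching_sum W E (cnj x) = cnj (matching_sum W E x)"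
  by (simp add: matching_sum_def)

text \<open>Heilmann--Lieb.\<close>
theorem matching_sum_zero_real:
  fixes x :: complex
  assumes "finite W" "simple_rel E" "matching_sum W E x = 0"
  shows "x \<in> \<real>"
proof (rule ccontr)
  assume "x \<notin> \<real>"
  then have "Im x > 0 \<or> Im (cnj x) > 0" by (auto simp: complex_is_Real_iff)
  then show False
    using matching_sum_ratio_Im[OF assms(1,2), of x] matching_sum_ratio_Im[OF assms(1,2), of "cnj x"]
      assms(3) by (auto simp: matching_sum_cnj)
qed

text \<open>Deleting vertices destroys regularity but keeps an upper bound on degrees, so the
  inductive estimates are stated with the bound.\<close>

definition max_degree_le :: "nat \<Rightarrow> 'a set \<Rightarrow> ('a \<Rightarrow> 'a \<Rightarrow> bool) \<Rightarrow> bool" where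
  "max_degree_le d V E \<longleftrightarrow> (\<forall>v\<in>V. card {u\<in>V. E v u} \<le> d)"

lemma max_degree_le_subset:
  assumes "max_degree_le d V E" "W \<subseteq> V" "finite V"
  shows "max_degree_le d W E"
  unfolding max_degree_le_def
proof
  fix v assume "v \<in> W"
  then have "card {u\<in>V. E v u} \<le> d" using assms by (auto simp: max_degree_le_def)
  moreover have "card {u\<in>W. E v u} \<le> card {u\<in>V. E v u}" using assms by (intro card_mono) auto
  ultimately show "card {u\<in>W. E v u} \<le> d" by linarith
qed

text \<open>The diagonal resolvent entry at the root of the tree of self-avoiding walks from
  \<open>u\<close> (Godsil's path tree).\<close>

definition removal_ratio :: "('a \<Rightarrow> 'a \<Rightarrow> bool) \<Rightarrow> real \<Rightarrow> 'a set \<Rightarrow> 'a \<Rightarrow> real" where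
  "removal_ratio E x W u = matching_sum (W - {u}) E x / matching_sum W E x"

lemma removal_ratio_rec:
  assumes "finite W" "simple_rel E" "u \<in> W" "matching_sum (W - {u}) E x \<noteq> 0"
  shows "removal_ratio E x W u
    = 1 / (x - (\<Sum>v | v \<in> W - {u} \<and> E u v. removal_ratio E x (W - {u}) v))"
proof -
  have eq: "W - {u} - {v} = W - {u, v}" for v by auto
  have "matching_sum W E x / matching_sum (W - {u}) E x
      = x - (\<Sum>v | v \<in> W - {u} \<and> E u v. removal_ratio E x (W - {u}) v)"
    unfolding removal_ratio_def eq
    using assms(4) matching_sum_rec[OF assms(1-3), of x]
    by (simp add: diff_divide_distrib sum_divide_distrib)
  then show ?thesis unfolding removal_ratio_def by (metis divide_divide_eq_right div_by_1 mult_1 times_divide_eq_left)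
qed

text \<open>If the ratios on \<open>W - {u}\<close> are at most \<open>1 / (d + 2)\<close>, their
  sum over at most \<open>d\<close> neighbours is at most \<open>d\<close>, so the denominator in
  the recursion has modulus at least \<open>2 * d + 2 - d\<close>, which reproduces the
  bound.\<close>

lemma matching_sum_ratio_bound:
  fixes x :: real
  assumes "finite W" "simple_rel E" "max_degree_le d W E" "\<bar>x\<bar> \<ge> 2 * real d + 2"
  shows "matching_sum W E x \<noteq> 0 \<and> (\<forall>u\<in>W. \<bar>removal_ratio E x W u\<bar> \<le> 1 / (real d + 2))"
  using assms(1,3)
proof (induction "card W" arbitrary: W rule: less_induct)
  case less
  have main: "matching_sum W E x \<noteq> 0 \<and> \<bar>removal_ratio E x W u\<bar> \<le> 1 / (real d + 2)" if u: "u \<in> W" for u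
  proof -
    have "max_degree_le d (W - {u}) E" by (rule max_degree_le_subset[OF less.prems(2)]) (use less.prems in auto)
    then have IH: "matching_sum (W - {u}) E x \<noteq> 0"
      "\<And>v. v \<in> W - {u} \<Longrightarrow> \<bar>removal_ratio E x (W - {u}) v\<bar> \<le> 1 / (real d + 2)"
      using less.hyps[OF card_Diff1_less[OF less.prems(1) u]] less.prems by auto
    let ?S = "\<Sum>v | v \<in> W - {u} \<and> E u v. removal_ratio E x (W - {u}) v"
    have "{v. v \<in> W - {u} \<and> E u v} = {v\<in>W. E u v}" using simple_rel_irrefl[OF assms(2)] by auto
    then have card: "card {v. v \<in> W - {u} \<and> E u v} \<le> d"
      using less.prems(2) u by (auto simp: max_degree_le_def)
    have "\<bar>?S\<bar> \<le> (\<Sum>v | v \<in> W - {u} \<and> E u v. 1 / (real d + 2))"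
      by (rule order_trans[OF sum_abs], rule sum_mono) (use IH in auto)
    also have "\<dots> = real (card {v. v \<in> W - {u} \<and> E u v}) * (1 / (real d + 2))" by simp
    also have "\<dots> \<le> real d * (1 / (real d + 2))" using card by (intro mult_right_mono) auto
    also have "\<dots> \<le> real d" by (simp add: field_simps)
    finally have S: "\<bar>x - ?S\<bar> \<ge> real d + 2" using assms(4) by linarith
    have "matching_sum W E x = (x - ?S) * matching_sum (W - {u}) E x"
    proof -
      have eq: "W - {u} - {v} = W - {u, v}" for v by auto
      show ?thesis
        unfolding removal_ratio_def eq
        using IH(1) matching_sum_rec[OF less.prems(1) assms(2) u, of x]
        by (simp add: algebra_simps sum_divide_distrib[symmetric])
    qed
    moreover have "x - ?S \<noteq> 0" using S by auto
    ultimately have "matching_sum W E x \<noteq> 0" using IH(1) by simp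
    moreover have "\<bar>removal_ratio E x W u\<bar> = 1 / \<bar>x - ?S\<bar>"
      using removal_ratio_rec[OF less.prems(1) assms(2) u IH(1)] by simp
    moreover have "1 / \<bar>x - ?S\<bar> \<le> 1 / (real d + 2)" by (rule divide_left_mono[OF S]) (use S in auto)
    ultimately show ?thesis by simp
  qed
  show ?case
  proof (cases "W = {}")
    case False
    then obtain u where "u \<in> W" by auto
    with main show ?thesis by blast
  qed simp
qed

lemma map_poly_of_real_add:
  "map_poly of_real (p + q) = map_poly of_real p + (map_poly of_real q :: 'b::{real_algebra_1,comm_ring_1} poly)"
  by (intro poly_eqI) (simp add: coeff_map_poly)

lemma map_poly_of_real_mult:
  "map_poly of_real (p * q) = map_poly of_real p * (map_poly of_real q :: 'b::{real_algebra_1,comm_ring_1} poly)"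
  by (induction p) (simp_all add: map_poly_of_real_add map_poly_pCons map_poly_smult)

text \<open>The fundamental theorem of algebra supplies a complex root, which the hypothesis makes
  real; after splitting it off, the roots of the cofactor are still roots of
  \<open>p\<close>.\<close>

lemma real_rooted_factorization:
  fixes p :: "real poly"
  assumes "p \<noteq> 0" "\<And>z::complex. poly (map_poly of_real p) z = 0 \<Longrightarrow> z \<in> \<real>"
  shows "p = smult (lead_coeff p) (\<Prod>a\<in>#proots p. [:-a, 1:])"
  using assms
proof (induction "degree p" arbitrary: p)
  case 0
  then obtain c where "p = [:c:]" by (metis degree_eq_zeroE)
  then show ?case by simp
next
  case (Suc n)
  have "degree (map_poly complex_of_real p) = degree p" by (rule degree_map_poly) auto
  then have "\<not> constant (poly (map_poly complex_of_real p))" using Suc.hyps(2) by (simp add: constant_degree)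
  then obtain z where z: "poly (map_poly complex_of_real p) z = 0" using fundamental_theorem_of_algebra by blast
  then obtain a where a: "z = of_real a" using Suc.prems(2) Reals_cases by metis
  have "poly (map_poly complex_of_real p) (of_real a) = of_real (poly p a)"
    by (simp add: poly_altdef degree_map_poly coeff_map_poly)
  then have "poly p a = 0" using z a by simp
  then obtain q where q: "p = [:-a, 1:] * q" by (auto simp: poly_eq_0_iff_dvd dvd_def)
  have q0: "q \<noteq> 0" using q Suc.prems(1) by auto
  have "degree q = n" using Suc.hyps(2) q0 unfolding q by (simp add: degree_mult_eq del: mult_pCons_left)
  moreover have "z \<in> \<real>" if "poly (map_poly of_real q) z = 0" for z :: complex
    by (rule Suc.prems(2)) (simp add: q map_poly_of_real_mult that del: mult_pCons_left)
  ultimately have "q = smult (lead_coeff q) (\<Prod>a\<in>#proots q. [:-a, 1:])"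
    using Suc.hyps(1)[of q] q0 by blast
  moreover have "proots p = {#a#} + proots q"
    unfolding q using q0 by (subst proots_mult) auto
  moreover have "lead_coeff p = lead_coeff q" unfolding q by (simp add: lead_coeff_mult del: mult_pCons_left)
  ultimately show ?case using q
    by (metis (no_types, lifting) add_mset_add_single image_mset_add_mset mult_smult_right prod_mset.add_mset union_commute)
qed

context
  fixes V :: "'a set" and E :: "'a \<Rightarrow> 'a \<Rightarrow> bool"
  assumes G: "fin_graph V E"
begin

lemma poly_matching_poly_real: "poly (matching_poly V E) x = matching_sum V E x"
proof -
  have "map_poly of_real (matching_poly V E) = matching_poly V E"
    by (rule map_poly_idI) simp
  then show ?thesis using poly_matching_poly[OF G, of x] by simp
qed

lemma matching_poly_monic: "degree (matching_poly V E) = card V" "lead_coeff (matching_poly V E) = 1"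
proof -
  have "{M. is_matching V E M \<and> card M = 0} = {{}}"
    using finite_matching[of V E] fin_graph_finite[OF G] by auto
  then have "num_matchings V E 0 = 1" by (simp add: num_matchings_def)
  moreover have "coeff (matching_poly V E) (card V) = (\<Sum>k\<le>card V div 2. if k = 0 then real (num_matchings V E 0) else 0)"
    unfolding matching_poly_def coeff_sum by (intro sum.cong refl) auto
  ultimately have 1: "coeff (matching_poly V E) (card V) = 1" by simp
  have "degree (matching_poly V E) \<le> card V"
    unfolding matching_poly_def by (intro degree_sum_le) (auto intro: order_trans[OF degree_monom_le])
  moreover have "degree (matching_poly V E) \<ge> card V" using 1 by (intro le_degree) auto
  ultimately show "degree (matching_poly V E) = card V" by simp
  then show "lead_coeff (matching_poly V E) = 1" using 1 by simp
qed

lemma matching_poly_nonzero: "matching_poly V E \<noteq> 0"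
  using matching_poly_monic(2) by auto

lemma matching_poly_factorization: "matching_poly V E = (\<Prod>a\<in>#proots (matching_poly V E). [:-a, 1:])"
proof -
  have "z \<in> \<real>" if "poly (map_poly of_real (matching_poly V E)) z = 0" for z :: complex
    using that matching_sum_zero_real[OF fin_graph_finite[OF G] fin_graph_simple[OF G]]
    by (simp add: poly_matching_poly[OF G])
  from real_rooted_factorization[OF matching_poly_nonzero this] show ?thesis
    by (simp add: matching_poly_monic(2))
qed

text \<open>Real-rootedness in numerical form: no zero escapes \<open>proots\<close> over the reals.
  This is why the matching measure has mass one.\<close>

lemma size_proots_matching_poly: "size (proots (matching_poly V E)) = card V"
proof -
  have nz: "(\<Prod>a\<in>#A. [:-a, 1::real:]) \<noteq> 0" for A
    by (induction A) (auto simp del: mult_pCons_left)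
  have "degree (\<Prod>a\<in>#A. [:-a, 1::real:]) = size A" for A
  proof (induction A)
    case (add a A)
    then show ?case using degree_mult_eq[OF _ nz, of "[:-a, 1:]" A] by simp
  qed simp
  then show ?thesis using matching_poly_factorization matching_poly_monic(1) by metis
qed

lemma matching_sum_eq_prod:
  "matching_sum V E x = (\<Prod>a\<in>#proots (matching_poly V E). x - of_real a :: 'b::{comm_ring_1,real_algebra_1})"
proof -
  have "poly (map_poly of_real (\<Prod>a\<in>#A. [:-a, 1:])) x = (\<Prod>a\<in>#A. x - of_real a)" for A
    by (induction A) (simp_all add: map_poly_of_real_mult map_poly_pCons del: mult_pCons_left)
  then show ?thesis using poly_matching_poly[OF G, of x] matching_poly_factorization by metis
qed

lemma proots_matching_poly_bound:
  assumes "max_degree_le d V E" "a \<in># proots (matching_poly V E)"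
  shows "\<bar>a\<bar> \<le> 2 * real d + 2"
proof (rule ccontr)
  assume "\<not> ?thesis"
  then have "matching_sum V E a \<noteq> 0"
    using matching_sum_ratio_bound[OF fin_graph_finite[OF G] fin_graph_simple[OF G] assms(1), of a] by auto
  then show False using assms(2) matching_poly_nonzero by (simp add: poly_matching_poly_real)
qed

end

lemma DERIV_prod_mset_linear:
  fixes x :: real
  assumes "\<And>a. a \<in># A \<Longrightarrow> x \<noteq> a"
  shows "((\<lambda>x. \<Prod>a\<in>#A. x - a) has_real_derivative (\<Prod>a\<in>#A. x - a) * (\<Sum>a\<in>#A. 1 / (x - a))) (at x)"
  using assms
proof (induction A)
  case (add a A)
  have "((\<lambda>x. (x - a) * (\<Prod>a\<in>#A. x - a)) has_real_derivative
      1 * (\<Prod>a\<in>#A. x - a) + (\<Prod>a\<in>#A. x - a) * (\<Sum>a\<in>#A. 1 / (x - a)) * (x - a)) (at x)"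
    by (rule DERIV_mult) (use add in \<open>auto intro!: derivative_eq_intros\<close>)
  moreover have "1 * P + P * S * (x - a) = (x - a) * P * (1 / (x - a) + S)" for P S
    using add.prems by (simp add: field_simps)
  ultimately show ?case by simp
qed simp

text \<open>Count pairs of a matching \<open>M\<close> and a vertex \<open>u\<close> that it misses:
  each \<open>M\<close> misses \<open>card V - 2 * card M\<close> vertices, the factor produced by
  differentiating its power of \<open>x\<close>.\<close>

lemma DERIV_matching_sum:
  fixes x :: real
  assumes fin: "finite V" and E: "simple_rel E"
  shows "((\<lambda>x. matching_sum V E x) has_real_derivative (\<Sum>u\<in>V. matching_sum (V - {u}) E x)) (at x)"
proof -
  let ?A = "{M. is_matching V E M}"
  have "(\<Sum>u\<in>V. matching_sum (V - {u}) E x)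
     = (\<Sum>u\<in>V. \<Sum>M\<in>?A. if u \<notin> \<Union>M then (-1) ^ card M * x ^ (card V - 2 * card M - 1) else 0)"
  proof (rule sum.cong[OF refl])
    fix u assume u: "u \<in> V"
    have "?A \<inter> {M. u \<notin> \<Union>M} = {M. is_matching (V - {u}) E M}" by (auto simp: is_matching_remove_iff)
    then show "matching_sum (V - {u}) E x = (\<Sum>M\<in>?A. if u \<notin> \<Union>M then (-1) ^ card M * x ^ (card V - 2 * card M - 1) else 0)"
      using u fin by (simp add: matching_sum_def sum.If_cases[OF finite_matchings[OF fin]] diff_commute)
  qed
  also have "\<dots> = (\<Sum>M\<in>?A. \<Sum>u\<in>V. if u \<notin> \<Union>M then (-1) ^ card M * x ^ (card V - 2 * card M - 1) else 0)"
    by (rule sum.swap)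
  also have "\<dots> = (\<Sum>M\<in>?A. (-1) ^ card M * (real (card V - 2 * card M) * x ^ (card V - 2 * card M - 1)))"
  proof (rule sum.cong[OF refl])
    fix M assume M: "M \<in> ?A"
    have "V \<inter> {u. u \<notin> \<Union>M} = V - \<Union>M" by auto
    moreover have "card (V - \<Union>M) = card V - 2 * card M"
      using card_matched_vertices[OF fin E] Union_matching_subset[of V E M] M fin
      by (subst card_Diff_subset) (auto intro: finite_subset)
    ultimately show "(\<Sum>u\<in>V. if u \<notin> \<Union>M then (-1) ^ card M * x ^ (card V - 2 * card M - 1) else 0)
       = (-1) ^ card M * (real (card V - 2 * card M) * x ^ (card V - 2 * card M - 1))"
      by (simp add: sum.If_cases[OF fin])
  qed
  finally show ?thesis
    unfolding matching_sum_def by (auto intro!: derivative_eq_intros sum.cong)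
qed

text \<open>Both sides are the logarithmic derivative of the matching polynomial at
  \<open>x\<close>, once from the zeros and once from vertex deletion. This turns a global statistic
  of the zeros into a sum of local quantities.\<close>

lemma sum_resolvent_roots:
  assumes G: "fin_graph V E" and d: "max_degree_le d V E" and x: "x > 2 * real d + 2"
  shows "(\<Sum>a\<in>#proots (matching_poly V E). 1 / (x - a)) = (\<Sum>u\<in>V. removal_ratio E x V u)"
proof -
  let ?A = "proots (matching_poly V E)"
  note fin = fin_graph_finite[OF G] and E = fin_graph_simple[OF G]
  have "matching_sum V E = (\<lambda>x::real. \<Prod>a\<in>#?A. x - a)"
    using matching_sum_eq_prod[OF G, where 'b=real] by auto
  moreover have "((\<lambda>x. \<Prod>a\<in>#?A. x - a) has_real_derivative (\<Prod>a\<in>#?A. x - a) * (\<Sum>a\<in>#?A. 1 / (x - a))) (at x)"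
    by (rule DERIV_prod_mset_linear) (use proots_matching_poly_bound[OF G d] x in fastforce)
  ultimately have "(\<Sum>u\<in>V. matching_sum (V - {u}) E x) = matching_sum V E x * (\<Sum>a\<in>#?A. 1 / (x - a))"
    using DERIV_matching_sum[OF fin E, of x] DERIV_unique by metis
  moreover have "matching_sum V E x \<noteq> 0" using matching_sum_ratio_bound[OF fin E d] x by auto
  ultimately show ?thesis
    by (simp add: removal_ratio_def sum_divide_distrib[symmetric])
qed

section \<open>The matching measure and averages over zeros\<close>

lemma emeasure_matching_measure_UNIV:
  assumes G: "fin_graph V E" and ne: "V \<noteq> {}"
  shows "emeasure (matching_measure V E) UNIV = 1"
proof -
  let ?p = "matching_poly V E"
  have "emeasure (matching_measure V E) UNIV
     = (\<integral>\<^sup>+z. ennreal (real (order z ?p) / real (card V)) \<partial>count_space UNIV)"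
    unfolding matching_measure_def by (simp add: emeasure_distr emeasure_density)
  also have "\<dots> = (\<Sum>z\<in>set_mset (proots ?p). ennreal (real (order z ?p) / real (card V)))"
  proof (rule nn_integral_count_space')
    show "finite (set_mset (proots ?p))" by simp
  qed (use matching_poly_nonzero[OF G] in \<open>auto simp: order_root\<close>)
  also have "\<dots> = ennreal (\<Sum>z\<in>set_mset (proots ?p). real (count (proots ?p) z) / real (card V))"
    using matching_poly_nonzero[OF G] by (subst sum_ennreal) auto
  also have "(\<Sum>z\<in>set_mset (proots ?p). real (count (proots ?p) z) / real (card V)) = real (size (proots ?p)) / real (card V)"
    by (simp add: sum_divide_distrib[symmetric] size_multiset_overloaded_eq)
  also have "\<dots> = 1" using size_proots_matching_poly[OF G] ne fin_graph_finite[OF G] by simp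
  finally show ?thesis by simp
qed

lemma real_distribution_matching_measure:
  assumes "fin_graph V E" "V \<noteq> {}"
  shows "real_distribution (matching_measure V E)"
proof -
  have "sets (matching_measure V E) = sets borel" by (simp add: matching_measure_def)
  moreover have "prob_space (matching_measure V E)"
    by (rule prob_spaceI) (use emeasure_matching_measure_UNIV[OF assms] in \<open>simp add: matching_measure_def\<close>)
  ultimately show ?thesis by (simp add: real_distribution_def real_distribution_axioms_def)
qed

text \<open>The integral against the matching measure as a finite sum, so that unbounded
  \<open>f\<close> raise no question of integrability.\<close>

definition root_average :: "'a set \<Rightarrow> ('a \<Rightarrow> 'a \<Rightarrow> bool) \<Rightarrow> (real \<Rightarrow> real) \<Rightarrow> real" where
  "root_average V E f = (\<Sum>a\<in>#proots (matching_poly V E). f a) / real (card V)"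

lemma sum_count_times:
  fixes f :: "'a \<Rightarrow> real"
  assumes "finite B" "set_mset A \<subseteq> B"
  shows "(\<Sum>z\<in>B. real (count A z) * f z) = (\<Sum>a\<in>#A. f a)"
  using assms(2)
proof (induction A)
  case (add a A)
  have "(\<Sum>z\<in>B. real (count (add_mset a A) z) * f z)
     = (\<Sum>z\<in>B. (if z = a then f z else 0) + real (count A z) * f z)"
    by (intro sum.cong) (auto simp: algebra_simps)
  also have "\<dots> = f a + (\<Sum>z\<in>B. real (count A z) * f z)"
    using add.prems assms(1) by (simp add: sum.distrib)
  finally show ?case using add by simp
qed simp

lemma integral_matching_measure:
  fixes f :: "real \<Rightarrow> real"
  assumes G: "fin_graph V E" and f: "f \<in> borel_measurable borel"
  shows "(\<integral>z. f z \<partial>matching_measure V E) = root_average V E f"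
proof -
  let ?p = "matching_poly V E" and ?n = "real (card V)"
  have "(\<integral>z. f z \<partial>matching_measure V E) = (\<integral>z. real (order z ?p) / ?n * f z \<partial>count_space UNIV)"
    unfolding matching_measure_def
    by (subst integral_distr) (use f in \<open>auto simp: integral_density\<close>)
  also have "\<dots> = (\<Sum>z\<in>set_mset (proots ?p). real (order z ?p) / ?n * f z)"
  proof -
    have sub: "{z \<in> UNIV. real (order z ?p) / ?n * f z \<noteq> 0} \<subseteq> set_mset (proots ?p)"
      using matching_poly_nonzero[OF G] by (auto simp: order_root)
    then show ?thesis
      by (subst lebesgue_integral_count_space_finite_support)
        (auto intro: finite_subset intro!: sum.mono_neutral_left)
  qed
  also have "\<dots> = (\<Sum>z\<in>set_mset (proots ?p). real (count (proots ?p) z) * f z) / ?n"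
    unfolding sum_divide_distrib using matching_poly_nonzero[OF G] by (intro sum.cong) auto
  also have "(\<Sum>z\<in>set_mset (proots ?p). real (count (proots ?p) z) * f z) = (\<Sum>a\<in>#proots ?p. f a)"
    by (rule sum_count_times) auto
  finally show ?thesis by (simp add: root_average_def)
qed

section \<open>Dependence of the zero distribution on the girth\<close>

definition matching_gen :: "'a set \<Rightarrow> ('a \<Rightarrow> 'a \<Rightarrow> bool) \<Rightarrow> real \<Rightarrow> real" where
  "matching_gen V E t = (\<Sum>M | is_matching V E M. t ^ card M)"

lemma matching_gen_ge_1:
  assumes "finite V" "t \<ge> 0"
  shows "matching_gen V E t \<ge> 1"
proof -
  have "(\<Sum>M\<in>{{} :: 'a set set}. t ^ card M) \<le> matching_gen V E t"
    unfolding matching_gen_def using assms finite_matchings[OF assms(1), of E]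
    by (intro sum_mono2) auto
  then show ?thesis by simp
qed

text \<open>At the point \<open>\<i> y\<close> with \<open>y\<^sup>2 t = 1\<close> all terms of the matching polynomial have the same phase.\<close>
lemma matching_sum_imaginary:
  fixes t y :: real
  assumes "finite V" "simple_rel E" "y\<^sup>2 * t = 1"
  shows "matching_sum V E (\<i> * of_real y) = \<i> ^ card V * of_real (y ^ card V * matching_gen V E t)"
proof -
  have "(-1) ^ card M * (\<i> * of_real y) ^ (card V - 2 * card M)
      = \<i> ^ card V * of_real (y ^ card V * t ^ card M)" if M: "is_matching V E M" for M
  proof -
    let ?k = "card M" and ?m = "card V - 2 * card M"
    have n: "card V = ?m + 2 * ?k" using card_matching_le[OF assms(1,2) M] by simp
    have "\<i> ^ card V = \<i> ^ ?m * (-1) ^ ?k" by (subst n) (simp add: power_add power_mult)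
    moreover have "y ^ card V * t ^ ?k = y ^ ?m * (y\<^sup>2 * t) ^ ?k"
      by (subst n) (simp add: power_add power_mult power_mult_distrib)
    ultimately show ?thesis using assms(3) by (simp add: power_mult_distrib)
  qed
  then show ?thesis
    unfolding matching_sum_def matching_gen_def
    by (simp add: sum_distrib_left)
qed

text \<open>Compute the modulus of the matching polynomial at the imaginary point
  \<open>\<i> * y\<close> with \<open>y = 1 / sqrt t\<close> twice: as a product over the zeros
  \<open>a\<close>, with factors \<open>y * sqrt (1 + t * a^2)\<close>, and from
  \<open>matching_sum_imaginary\<close>. The powers of \<open>y\<close> cancel.\<close>

lemma root_average_ln:
  assumes G: "fin_graph V E" and t: "t > 0"
  shows "root_average V E (\<lambda>z. ln (1 + t * z\<^sup>2) / 2) = ln (matching_gen V E t) / real (card V)"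
proof -
  define y where "y = 1 / sqrt t"
  have y: "y > 0" "y\<^sup>2 * t = 1" using t by (auto simp: y_def power_divide)
  let ?f = "\<lambda>z. ln (1 + t * z\<^sup>2) / 2"
  have factor: "cmod (\<i> * of_real y - of_real a) = y * exp (?f a)" for a
  proof -
    have "1 + t * a\<^sup>2 > 0" using t by (simp add: add_pos_nonneg)
    then have "exp (?f a) = sqrt (1 + t * a\<^sup>2)" by (simp add: ln_sqrt[symmetric])
    moreover have "y\<^sup>2 + a\<^sup>2 = y\<^sup>2 * (1 + t * a\<^sup>2)"
      using y(2) by (simp add: algebra_simps)
    ultimately show ?thesis using y(1) by (simp add: cmod_def add.commute real_sqrt_mult)
  qed
  have "cmod (\<Prod>a\<in>#A. \<i> * of_real y - of_real a) = y ^ size A * exp (\<Sum>a\<in>#A. ?f a)" for A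
    by (induction A) (simp_all add: norm_mult factor exp_add)
  then have "cmod (matching_sum V E (\<i> * of_real y))
      = y ^ card V * exp (\<Sum>a\<in>#proots (matching_poly V E). ?f a)"
    unfolding matching_sum_eq_prod[OF G] size_proots_matching_poly[OF G, symmetric] by blast
  moreover have g: "matching_gen V E t > 0" using matching_gen_ge_1[OF fin_graph_finite[OF G], of t E] t by linarith
  then have "cmod (matching_sum V E (\<i> * of_real y)) = y ^ card V * matching_gen V E t"
    unfolding matching_sum_imaginary[OF fin_graph_finite[OF G] fin_graph_simple[OF G] y(2)]
    using y(1) by (simp add: norm_mult norm_power)
  ultimately have "exp (\<Sum>a\<in>#proots (matching_poly V E). ?f a) = matching_gen V E t" using y(1) by simp
  then have "(\<Sum>a\<in>#proots (matching_poly V E). ?f a) = ln (matching_gen V E t)" by (metis ln_exp)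
  then show ?thesis by (simp add: root_average_def)
qed

lemma regular_max_degree: "regular d V E \<Longrightarrow> max_degree_le d V E"
  by (simp add: regular_def max_degree_le_def)

lemma root_average_diff_le:
  assumes G: "fin_graph V E" and ne: "V \<noteq> {}" and d: "max_degree_le d V E"
    and e: "\<And>z. \<bar>z\<bar> \<le> 2 * real d + 2 \<Longrightarrow> \<bar>f z - g z\<bar> \<le> e"
  shows "\<bar>root_average V E f - root_average V E g\<bar> \<le> e"
proof -
  let ?A = "proots (matching_poly V E)"
  have "\<bar>(\<Sum>a\<in>#A. f a) - (\<Sum>a\<in>#A. g a)\<bar> \<le> real (size A) * e" if "set_mset A \<subseteq> set_mset ?A" for A
    using that
  proof (induction A)
    case (add a A)
    have "\<bar>f a - g a\<bar> \<le> e" using proots_matching_poly_bound[OF G d, of a] add.prems e by simp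
    then show ?case using add by (simp add: algebra_simps)
  qed simp
  from this[of ?A] have "\<bar>(\<Sum>a\<in>#?A. f a) - (\<Sum>a\<in>#?A. g a)\<bar> \<le> real (card V) * e"
    using size_proots_matching_poly[OF G] by simp
  then show ?thesis
    using ne fin_graph_finite[OF G]
    by (simp add: root_average_def diff_divide_distrib[symmetric] abs_divide pos_divide_le_eq card_gt_0_iff mult.commute)
qed

lemma root_average_linear:
  "root_average V E (\<lambda>z. b * f z + c * g z) = b * root_average V E f + c * root_average V E g"
proof -
  have "(\<Sum>a\<in>#A. b * f a + c * g a) = b * (\<Sum>a\<in>#A. f a) + c * (\<Sum>a\<in>#A. g a)" for A
    by (induction A) (auto simp: algebra_simps)
  then show ?thesis by (simp add: root_average_def add_divide_distrib)
qed

lemma root_average_cong: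
  assumes "fin_graph V E" "max_degree_le d V E" "\<And>z. \<bar>z\<bar> \<le> 2 * real d + 2 \<Longrightarrow> f z = g z"
  shows "root_average V E f = root_average V E g"
proof -
  have "image_mset f (proots (matching_poly V E)) = image_mset g (proots (matching_poly V E))"
    by (rule image_mset_cong) (use proots_matching_poly_bound[OF assms(1,2)] assms(3) in auto)
  then show ?thesis by (simp add: root_average_def)
qed

section \<open>Comparison of the ratios with a regular tree\<close>

text \<open>The root ratio of the tree with \<open>d - 1\<close> children per vertex, cut to
  \<open>r\<close> levels. The initial value 0 is only a starting guess, whose influence the
  contraction halves at every level.\<close>

primrec tree_ratio :: "nat \<Rightarrow> real \<Rightarrow> nat \<Rightarrow> real" where
  "tree_ratio d x 0 = 0"
| "tree_ratio d x (Suc r) = 1 / (x - (real d - 1) * tree_ratio d x r)"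

lemma tree_ratio_bound:
  assumes "d \<ge> 1" "x \<ge> 2 * real d + 2"
  shows "\<bar>tree_ratio d x r\<bar> \<le> 1"
proof (induction r)
  case (Suc r)
  have "\<bar>(real d - 1) * tree_ratio d x r\<bar> \<le> (real d - 1) * 1"
    unfolding abs_mult using Suc assms(1) by (intro mult_mono) auto
  then have "(real d - 1) * tree_ratio d x r \<le> real d - 1" by (simp only: abs_le_iff mult_1_right)
  then have "x - (real d - 1) * tree_ratio d x r \<ge> 1" using assms by linarith
  then show ?case by (simp add: divide_le_eq)
qed simp

text \<open>The difference is \<open>(S - S') / ((x - S) * (x - S'))\<close> up to sign, and
  \<open>c / (c + 2)^2\<close> is at most one half. With \<open>c = d\<close> this is the
  contraction per level.\<close>

lemma resolvent_contraction:
  fixes x S S' e c :: real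
  assumes "\<bar>S - S'\<bar> \<le> c * e" "\<bar>x - S\<bar> \<ge> c + 2" "\<bar>x - S'\<bar> \<ge> c + 2" "e \<ge> 0" "c \<ge> 0"
  shows "\<bar>1 / (x - S) - 1 / (x - S')\<bar> \<le> e / 2"
proof -
  have nz: "x - S \<noteq> 0" "x - S' \<noteq> 0" using assms by auto
  then have "\<bar>1 / (x - S) - 1 / (x - S')\<bar> = \<bar>S - S'\<bar> / (\<bar>x - S\<bar> * \<bar>x - S'\<bar>)"
    by (simp add: diff_frac_eq abs_mult)
  also have "\<dots> \<le> (c * e) / ((c + 2) * (c + 2))"
    using assms by (intro frac_le mult_mono mult_pos_pos) auto
  also have "\<dots> \<le> e / 2"
  proof -
    have "2 * (c * e) \<le> ((c + 2) * (c + 2)) * e"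
    proof -
      have "2 * c \<le> (c + 2) * (c + 2)" using assms(5) by (simp add: algebra_simps)
      from mult_right_mono[OF this assms(4)] show ?thesis by (simp add: mult_ac)
    qed
    moreover have "(c + 2) * (c + 2) > 0" using assms(5) by (intro mult_pos_pos) auto
    ultimately show ?thesis by (simp add: field_simps)
  qed
  finally show ?thesis .
qed

text \<open>Paths grow at the head: in \<open>u # q\<close> the recursion stands at
  \<open>u\<close>, the vertices of \<open>q\<close> have been deleted, and \<open>hd q\<close> is
  the predecessor of \<open>u\<close>.\<close>

definition path_in :: "'a set \<Rightarrow> ('a \<Rightarrow> 'a \<Rightarrow> bool) \<Rightarrow> 'a list \<Rightarrow> bool" where
  "path_in V E p \<longleftrightarrow> distinct p \<and> set p \<subseteq> V \<and> (\<forall>i. Suc i < length p \<longrightarrow> E (p ! i) (p ! Suc i))"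

text \<open>A neighbour \<open>q ! j\<close> with \<open>j > 0\<close> would close the first
  \<open>j + 2\<close> vertices of the path to a cycle shorter than \<open>N\<close>. In a
  \<open>d\<close>-regular graph, \<open>u\<close> therefore keeps exactly \<open>d - 1\<close>
  neighbours after the deletion of \<open>q\<close>.\<close>

lemma path_in_chord:
  assumes E: "simple_rel E" and p: "path_in V E (u # q)" and g: "girth_ge V E N"
    and len: "Suc (length q) < N" and q: "q \<noteq> []"
  shows "{v\<in>V. E u v} \<inter> set q = {hd q}"
proof (intro equalityI subsetI)
  fix v assume v: "v \<in> {v\<in>V. E u v} \<inter> set q"
  then obtain j where j: "j < length q" "v = q ! j" by (auto simp: in_set_conv_nth)
  show "v \<in> {hd q}"
  proof (rule ccontr)
    assume "v \<notin> {hd q}"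
    then have j0: "j > 0" using j q by (cases j) (auto simp: hd_conv_nth)
    let ?c = "take (Suc (Suc j)) (u # q)"
    have lc: "length ?c = Suc (Suc j)" using j by simp
    have "E (?c ! i) (?c ! ((i + 1) mod Suc (Suc j)))" if "i < Suc (Suc j)" for i
    proof (cases "i = Suc j")
      case True
      then show ?thesis using j v simple_rel_sym[OF E, of u v] by simp
    next
      case False
      then have "E ((u # q) ! i) ((u # q) ! Suc i)" using p that j by (auto simp: path_in_def)
      moreover have "?c ! i = (u # q) ! i" "?c ! Suc i = (u # q) ! Suc i"
        using False that by (auto simp del: take_Suc_Cons intro!: nth_take)
      ultimately show ?thesis using False that by simp
    qed
    moreover have "distinct ?c" "set ?c \<subseteq> V"
      using p set_take_subset[of "Suc (Suc j)" "u # q"] by (auto simp: path_in_def simp del: take_Suc_Cons)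
    ultimately have "has_cycle_of_length V E (Suc (Suc j))"
      unfolding has_cycle_of_length_def using lc j0 by (intro conjI exI[of _ ?c]) auto
    then show False using g len j by (auto simp: girth_ge_def)
  qed
next
  fix v assume "v \<in> {hd q}"
  moreover have "E ((u # q) ! 0) ((u # q) ! Suc 0)" using p q unfolding path_in_def by (metis length_Cons length_greater_0_conv Suc_less_eq)
  ultimately show "v \<in> {v\<in>V. E u v} \<inter> set q" using q p by (auto simp: path_in_def hd_conv_nth)
qed

text \<open>Up to depth \<open>r\<close> the recursion for the ratio after removing a path sees a tree in which every
  vertex has \<open>d - 1\<close> children.\<close>
lemma removal_ratio_path:
  assumes G: "fin_graph V E" and reg: "regular d V E" and d: "d \<ge> 1" and g: "girth_ge V E N"
    and x: "x \<ge> 2 * real d + 2"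
    and "path_in V E (u # q)" "q \<noteq> []" "Suc (length q) + r \<le> N"
  shows "\<bar>removal_ratio E x (V - set q) u - tree_ratio d x r\<bar> \<le> (1 / 2) ^ r"
  using assms(6-8)
proof (induction r arbitrary: u q)
  case (0 u q)
  have "u \<in> V - set q" using 0 by (auto simp: path_in_def)
  moreover have "max_degree_le d (V - set q) E"
    by (rule max_degree_le_subset[OF regular_max_degree[OF reg]]) (use fin_graph_finite[OF G] in auto)
  ultimately have "\<bar>removal_ratio E x (V - set q) u\<bar> \<le> 1 / (real d + 2)"
    using matching_sum_ratio_bound[of "V - set q" E d x] x fin_graph_finite[OF G] fin_graph_simple[OF G] by auto
  also have "\<dots> \<le> 1" by simp
  finally show ?case by simp
next
  case (Suc r u q)
  note fin = fin_graph_finite[OF G] and E = fin_graph_simple[OF G]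
  let ?W = "V - set q" and ?N = "{v. v \<in> V - set q - {u} \<and> E u v}"
  have md: "max_degree_le d (V - S) E" for S
    by (rule max_degree_le_subset[OF regular_max_degree[OF reg]]) (use fin in auto)
  have uW: "u \<in> ?W" using Suc.prems by (auto simp: path_in_def)
  have W': "?W - {u} = V - set (u # q)" by auto
  have nz: "matching_sum (?W - {u}) E x \<noteq> 0"
    using matching_sum_ratio_bound[of "V - set (u # q)" E d x] md[of "set (u # q)"] fin E x unfolding W' by auto
  have N: "?N = {v\<in>V. E u v} - set q" using simple_rel_irrefl[OF E] by auto
  have "card ?N = card {v\<in>V. E u v} - card ({v\<in>V. E u v} \<inter> set q)"
    unfolding N by (rule card_Diff_subset_Int) auto
  moreover have "card {v\<in>V. E u v} = d" using reg Suc.prems by (auto simp: regular_def path_in_def)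
  ultimately have cN: "card ?N = d - 1"
    using path_in_chord[OF E Suc.prems(1) g _ Suc.prems(2)] Suc.prems(3) by simp
  let ?S = "\<Sum>v\<in>?N. removal_ratio E x (?W - {u}) v" and ?T = "(real d - 1) * tree_ratio d x r"
  have IH: "\<bar>removal_ratio E x (?W - {u}) v - tree_ratio d x r\<bar> \<le> (1 / 2) ^ r" if v: "v \<in> ?N" for v
  proof -
    have "path_in V E (v # u # q)"
      unfolding path_in_def
    proof (intro conjI allI impI)
      fix i assume "Suc i < length (v # u # q)"
      then show "E ((v # u # q) ! i) ((v # u # q) ! Suc i)"
        using v Suc.prems(1) simple_rel_sym[OF E, of u v] by (cases i) (auto simp: path_in_def)
    qed (use v Suc.prems(1) in \<open>auto simp: path_in_def\<close>)
    from Suc.IH[OF this] show ?thesis using Suc.prems(3) unfolding W' by simp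
  qed
  have bnd: "\<bar>removal_ratio E x (?W - {u}) v\<bar> \<le> 1" if v: "v \<in> ?N" for v
  proof -
    have "\<bar>removal_ratio E x (?W - {u}) v\<bar> \<le> 1 / (real d + 2)"
      using matching_sum_ratio_bound[of "V - set (u # q)" E d x] md[of "set (u # q)"] fin E x v unfolding W' by auto
    also have "\<dots> \<le> 1" by simp
    finally show ?thesis .
  qed
  have "?S - ?T = (\<Sum>v\<in>?N. removal_ratio E x (?W - {u}) v - tree_ratio d x r)"
    using cN d by (simp add: sum_subtractf of_nat_diff)
  also have "\<bar>\<dots>\<bar> \<le> (\<Sum>v\<in>?N. (1 / 2) ^ r)"
    by (rule order_trans[OF sum_abs], rule sum_mono) (use IH in auto)
  also have "\<dots> \<le> real d * (1 / 2) ^ r" using cN d by (simp add: mult_right_mono)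
  finally have diff: "\<bar>?S - ?T\<bar> \<le> real d * (1 / 2) ^ r" .
  have "\<bar>?S\<bar> \<le> (\<Sum>v\<in>?N. 1)"
    by (rule order_trans[OF sum_abs], rule sum_mono) (use bnd in auto)
  also have "\<dots> \<le> real d" using cN by simp
  finally have S: "\<bar>?S\<bar> \<le> real d" .
  have "\<bar>?T\<bar> \<le> (real d - 1) * 1"
    unfolding abs_mult using tree_ratio_bound[OF d x, of r] d by (intro mult_mono) auto
  then have T: "\<bar>?T\<bar> \<le> real d" by simp
  have "\<bar>1 / (x - ?S) - 1 / (x - ?T)\<bar> \<le> (1 / 2) ^ r / 2"
    by (rule resolvent_contraction[OF diff]) (use S T x in auto)
  then show ?case using removal_ratio_rec[OF _ E uW nz] fin by simp
qed

text \<open>The root keeps all \<open>d\<close> neighbours, unlike the vertices below it, so the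
  last step of the recursion is done separately. Its neighbours start from paths of two vertices,
  which explains \<open>2 + r\<close>.\<close>

lemma removal_ratio_vertex:
  assumes G: "fin_graph V E" and reg: "regular d V E" and d: "d \<ge> 1" and g: "girth_ge V E N"
    and x: "x \<ge> 2 * real d + 2" and u: "u \<in> V" and r: "2 + r \<le> N"
  shows "\<bar>removal_ratio E x V u - 1 / (x - real d * tree_ratio d x r)\<bar> \<le> (1 / 2) ^ r"
proof -
  note fin = fin_graph_finite[OF G] and E = fin_graph_simple[OF G]
  let ?N = "{v. v \<in> V - {u} \<and> E u v}"
  have md: "max_degree_le d (V - {u}) E"
    by (rule max_degree_le_subset[OF regular_max_degree[OF reg]]) (use fin in auto)
  have nz: "matching_sum (V - {u}) E x \<noteq> 0"
    using matching_sum_ratio_bound[of "V - {u}" E d x] md fin E x by auto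
  have N: "?N = {v\<in>V. E u v}" using simple_rel_irrefl[OF E] by auto
  have cN: "card ?N = d" unfolding N using reg u by (auto simp: regular_def)
  let ?S = "\<Sum>v\<in>?N. removal_ratio E x (V - {u}) v" and ?T = "real d * tree_ratio d x r"
  have IH: "\<bar>removal_ratio E x (V - {u}) v - tree_ratio d x r\<bar> \<le> (1 / 2) ^ r" if v: "v \<in> ?N" for v
  proof -
    have "path_in V E (v # [u])" using v u simple_rel_sym[OF E, of u v] by (auto simp: path_in_def nth_Cons split: nat.splits)
    from removal_ratio_path[OF G reg d g x this] show ?thesis using r by simp
  qed
  have bnd: "\<bar>removal_ratio E x (V - {u}) v\<bar> \<le> 1" if v: "v \<in> ?N" for v
  proof -
    have "\<bar>removal_ratio E x (V - {u}) v\<bar> \<le> 1 / (real d + 2)"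
      using matching_sum_ratio_bound[of "V - {u}" E d x] md fin E x v by auto
    also have "\<dots> \<le> 1" by simp
    finally show ?thesis .
  qed
  have "?S - ?T = (\<Sum>v\<in>?N. removal_ratio E x (V - {u}) v - tree_ratio d x r)"
    using cN by (simp add: sum_subtractf)
  also have "\<bar>\<dots>\<bar> \<le> (\<Sum>v\<in>?N. (1 / 2) ^ r)"
    by (rule order_trans[OF sum_abs], rule sum_mono) (use IH in auto)
  also have "\<dots> \<le> real d * (1 / 2) ^ r" using cN by simp
  finally have diff: "\<bar>?S - ?T\<bar> \<le> real d * (1 / 2) ^ r" .
  have "\<bar>?S\<bar> \<le> (\<Sum>v\<in>?N. 1)"
    by (rule order_trans[OF sum_abs], rule sum_mono) (use bnd in auto)
  also have "\<dots> \<le> real d" using cN by simp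
  finally have S: "\<bar>?S\<bar> \<le> real d" .
  have "\<bar>?T\<bar> \<le> real d * 1"
    unfolding abs_mult using tree_ratio_bound[OF d x, of r] by (intro mult_mono) auto
  then have T: "\<bar>?T\<bar> \<le> real d" by simp
  have "\<bar>1 / (x - ?S) - 1 / (x - ?T)\<bar> \<le> (1 / 2) ^ r / 2"
    by (rule resolvent_contraction[OF diff]) (use S T x in auto)
  also have "\<dots> \<le> (1 / 2) ^ r" by simp
  finally show ?thesis using removal_ratio_rec[OF fin E u nz] by simp
qed

section \<open>Functions whose averages over the zeros are determined by large girth\<close>

text \<open>A Cauchy-type condition: \<open>c\<close> is chosen after \<open>e\<close>, so no limit
  has to be named, and the property passes to uniform limits on the interval of zeros. The vertex
  type is \<open>nat\<close> as in \<open>large_girth_seq\<close>.\<close>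

definition girth_determined :: "nat \<Rightarrow> (real \<Rightarrow> real) \<Rightarrow> bool" where
  "girth_determined d f \<longleftrightarrow> (\<forall>e>0. \<exists>N c. \<forall>(V::nat set) E. fin_graph V E \<and> V \<noteq> {} \<and> regular d V E \<and> girth_ge V E N
     \<longrightarrow> \<bar>root_average V E f - c\<bar> \<le> e)"

lemma girth_determined_resolvent:
  assumes d: "d \<ge> 1" and x: "x > 2 * real d + 2"
  shows "girth_determined d (\<lambda>z. 1 / (x - z))"
  unfolding girth_determined_def
proof (intro allI impI)
  fix e :: real assume "e > 0"
  then obtain r where r: "(1 / 2 :: real) ^ r < e" using real_arch_pow_inv[of e "1 / 2"] by auto
  let ?c = "1 / (x - real d * tree_ratio d x r)"
  have "\<bar>root_average V E (\<lambda>z. 1 / (x - z)) - ?c\<bar> \<le> e"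
    if G: "fin_graph V E" "V \<noteq> {}" "regular d V E" "girth_ge V E (2 + r)" for V :: "nat set" and E
  proof -
    have n: "card V > 0" using G fin_graph_finite[OF G(1)] by (simp add: card_gt_0_iff)
    have "root_average V E (\<lambda>z. 1 / (x - z)) = (\<Sum>u\<in>V. removal_ratio E x V u) / real (card V)"
      using sum_resolvent_roots[OF G(1) regular_max_degree[OF G(3)] x] by (simp add: root_average_def)
    also have "\<dots> - ?c = (\<Sum>u\<in>V. removal_ratio E x V u - ?c) / real (card V)"
      using n by (simp add: sum_subtractf diff_divide_distrib)
    finally have eq: "root_average V E (\<lambda>z. 1 / (x - z)) - ?c = (\<Sum>u\<in>V. removal_ratio E x V u - ?c) / real (card V)" .
    have "\<bar>\<Sum>u\<in>V. removal_ratio E x V u - ?c\<bar> \<le> (\<Sum>u\<in>V. (1 / 2) ^ r)"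
      by (rule order_trans[OF sum_abs], rule sum_mono)
        (use removal_ratio_vertex[OF G(1,3) d G(4)] x in auto)
    then have "\<bar>\<Sum>u\<in>V. removal_ratio E x V u - ?c\<bar> \<le> real (card V) * (1 / 2) ^ r" by simp
    then have "\<bar>root_average V E (\<lambda>z. 1 / (x - z)) - ?c\<bar> \<le> (1 / 2) ^ r"
      unfolding eq using n by (simp add: abs_divide pos_divide_le_eq mult.commute)
    then show ?thesis using r by linarith
  qed
  then show "\<exists>N c. \<forall>(V::nat set) E. fin_graph V E \<and> V \<noteq> {} \<and> regular d V E \<and> girth_ge V E N
     \<longrightarrow> \<bar>root_average V E (\<lambda>z. 1 / (x - z)) - c\<bar> \<le> e" by blast
qed

lemma girth_ge_mono: "girth_ge V E N \<Longrightarrow> M \<le> N \<Longrightarrow> girth_ge V E M"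
  by (auto simp: girth_ge_def)

lemma girth_determined_approx:
  assumes "\<And>e. e > 0 \<Longrightarrow> \<exists>g. girth_determined d g \<and> (\<forall>z. \<bar>z\<bar> \<le> 2 * real d + 2 \<longrightarrow> \<bar>f z - g z\<bar> \<le> e)"
  shows "girth_determined d f"
  unfolding girth_determined_def
proof (intro allI impI)
  fix e :: real assume e: "e > 0"
  from assms[of "e / 2"] e obtain g where g: "girth_determined d g" "\<And>z. \<bar>z\<bar> \<le> 2 * real d + 2 \<Longrightarrow> \<bar>f z - g z\<bar> \<le> e / 2"
    by auto
  from g(1) e obtain N c where N: "\<And>(V::nat set) E. fin_graph V E \<Longrightarrow> V \<noteq> {} \<Longrightarrow> regular d V E \<Longrightarrow> girth_ge V E N
     \<Longrightarrow> \<bar>root_average V E g - c\<bar> \<le> e / 2"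
    unfolding girth_determined_def by (meson half_gt_zero)
  have "\<bar>root_average V E f - c\<bar> \<le> e"
    if "fin_graph V E" "V \<noteq> {}" "regular d V E" "girth_ge V E N" for V :: "nat set" and E
    using root_average_diff_le[where f = f and g = g, OF that(1,2) regular_max_degree[OF that(3)] g(2)] N[OF that] by linarith
  then show "\<exists>N c. \<forall>(V::nat set) E. fin_graph V E \<and> V \<noteq> {} \<and> regular d V E \<and> girth_ge V E N
     \<longrightarrow> \<bar>root_average V E f - c\<bar> \<le> e" by blast
qed

lemma girth_determined_cong:
  assumes "girth_determined d g" "\<And>z. \<bar>z\<bar> \<le> 2 * real d + 2 \<Longrightarrow> f z = g z"
  shows "girth_determined d f"
  by (rule girth_determined_approx) (use assms in force)

lemma girth_determined_linear:
  assumes "girth_determined d f" "girth_determined d g"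
  shows "girth_determined d (\<lambda>z. a * f z + b * g z)"
  unfolding girth_determined_def
proof (intro allI impI)
  fix e :: real assume e: "e > 0"
  define k where "k = \<bar>a\<bar> + \<bar>b\<bar> + 1"
  have k: "k > 0" by (simp add: k_def)
  from assms(1) e k obtain N c where N: "\<And>(V::nat set) E. fin_graph V E \<Longrightarrow> V \<noteq> {} \<Longrightarrow> regular d V E \<Longrightarrow> girth_ge V E N
     \<Longrightarrow> \<bar>root_average V E f - c\<bar> \<le> e / k"
    unfolding girth_determined_def by (meson divide_pos_pos)
  from assms(2) e k obtain N' c' where N': "\<And>(V::nat set) E. fin_graph V E \<Longrightarrow> V \<noteq> {} \<Longrightarrow> regular d V E \<Longrightarrow> girth_ge V E N'
     \<Longrightarrow> \<bar>root_average V E g - c'\<bar> \<le> e / k"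
    unfolding girth_determined_def by (meson divide_pos_pos)
  have "\<bar>root_average V E (\<lambda>z. a * f z + b * g z) - (a * c + b * c')\<bar> \<le> e"
    if G: "fin_graph V E" "V \<noteq> {}" "regular d V E" "girth_ge V E (max N N')" for V :: "nat set" and E
  proof -
    have "\<bar>root_average V E f - c\<bar> \<le> e / k" "\<bar>root_average V E g - c'\<bar> \<le> e / k"
      using N[OF G(1-3)] N'[OF G(1-3)] girth_ge_mono[OF G(4)] by auto
    then have "\<bar>a\<bar> * \<bar>root_average V E f - c\<bar> + \<bar>b\<bar> * \<bar>root_average V E g - c'\<bar> \<le> \<bar>a\<bar> * (e / k) + \<bar>b\<bar> * (e / k)"
      by (intro add_mono mult_left_mono) auto
    also have "\<dots> = (\<bar>a\<bar> + \<bar>b\<bar>) * (e / k)" by (simp add: algebra_simps)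
    also have "\<dots> \<le> k * (e / k)" by (rule mult_right_mono) (use e k in \<open>auto simp: k_def\<close>)
    also have "\<dots> = e" using k by simp
    finally have "\<bar>a * (root_average V E f - c)\<bar> + \<bar>b * (root_average V E g - c')\<bar> \<le> e" by (simp add: abs_mult)
    moreover have "root_average V E (\<lambda>z. a * f z + b * g z) - (a * c + b * c')
      = a * (root_average V E f - c) + b * (root_average V E g - c')"
      by (simp add: root_average_linear algebra_simps)
    ultimately show ?thesis by linarith
  qed
  then show "\<exists>N c. \<forall>(V::nat set) E. fin_graph V E \<and> V \<noteq> {} \<and> regular d V E \<and> girth_ge V E N
     \<longrightarrow> \<bar>root_average V E (\<lambda>z. a * f z + b * g z) - c\<bar> \<le> e" by blast
qed

text \<open>As \<open>x \<longrightarrow> \<infinity>\<close>, \<open>x z\<^sup>k / (x - z)\<close> tends to \<open>z\<^sup>k\<close> uniformly on the interval containing all zeros.\<close>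
lemma girth_determined_power_resolvent:
  assumes d: "d \<ge> 1"
  shows "\<forall>x > 2 * real d + 2. girth_determined d (\<lambda>z. z ^ k / (x - z))"
    and "girth_determined d (\<lambda>z. z ^ k)"
proof -
  let ?C = "2 * real d + 2"
  have lim: "girth_determined d (\<lambda>z. z ^ k)" if res: "\<forall>x > ?C. girth_determined d (\<lambda>z. z ^ k / (x - z))" for k
  proof (rule girth_determined_approx)
    fix e :: real assume e: "e > 0"
    \<comment> \<open>With this choice \<open>x - z\<close> exceeds \<open>?C ^ Suc k / e\<close> on
      the whole interval, which bounds the error \<open>z ^ Suc k / (x - z)\<close> by
      \<open>e\<close>.\<close>
    define x where "x = ?C + ?C ^ Suc k / e + 1"
    have CC: "?C ^ Suc k / e > 0" using e by (intro divide_pos_pos zero_less_power) auto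
    then have x: "x > ?C" unfolding x_def by linarith
    \<comment> \<open>The zero summand only gives the product the two-term shape of
      \<open>girth_determined_linear\<close>.\<close>
    let ?g = "\<lambda>z. x * (z ^ k / (x - z)) + 0 * (z ^ k / (x - z))"
    have "girth_determined d ?g" using res x by (intro girth_determined_linear) auto
    moreover have "\<bar>z ^ k - ?g z\<bar> \<le> e" if z: "\<bar>z\<bar> \<le> ?C" for z
    proof -
      have xz: "x - z > 0" using z x by linarith
      have "z ^ k - ?g z = - (z ^ Suc k / (x - z))" using xz by (simp add: field_simps)
      then have "\<bar>z ^ k - ?g z\<bar> = \<bar>z\<bar> ^ Suc k / (x - z)" using xz by (simp add: abs_mult power_abs)
      also have "\<dots> \<le> ?C ^ Suc k / (?C ^ Suc k / e)"
        by (rule frac_le[OF _ _ CC]) (use z xz x_def in \<open>auto intro!: power_mono simp del: power_Suc\<close>)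
      also have "\<dots> = e" using e by simp
      finally show ?thesis .
    qed
    ultimately show "\<exists>g. girth_determined d g \<and> (\<forall>z. \<bar>z\<bar> \<le> ?C \<longrightarrow> \<bar>z ^ k - g z\<bar> \<le> e)" by blast
  qed
  have res: "\<forall>x > ?C. girth_determined d (\<lambda>z. z ^ k / (x - z))" for k
  proof (induction k)
    case 0
    then show ?case using girth_determined_resolvent[OF d] by simp
  next
    case (Suc k)
    show ?case
    proof (intro allI impI)
      fix x assume x: "x > ?C"
      \<comment> \<open>Division with remainder:
        \<open>z ^ Suc k / (x - z) = x * (z ^ k / (x - z)) - z ^ k\<close>, and \<open>z ^ k\<close>
        is already available from the resolvents with the same \<open>k\<close>.\<close>
      have "girth_determined d (\<lambda>z. x * (z ^ k / (x - z)) + (-1) * z ^ k)"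
        using Suc lim[OF Suc] x by (intro girth_determined_linear) auto
      then show "girth_determined d (\<lambda>z. z ^ Suc k / (x - z))"
        by (rule girth_determined_cong) (use x in \<open>auto simp: field_simps\<close>)
    qed
  qed
  show "\<forall>x > ?C. girth_determined d (\<lambda>z. z ^ k / (x - z))" by (rule res)
  show "girth_determined d (\<lambda>z. z ^ k)" by (rule lim[OF res])
qed

text \<open>Only values on the compact interval of zeros enter, so Stone-Weierstrass reduces the
  claim to powers.\<close>

lemma girth_determined_continuous:
  assumes d: "d \<ge> 1" and f: "continuous_on UNIV f"
  shows "girth_determined d f"
proof (rule girth_determined_approx)
  let ?C = "2 * real d + 2"
  fix e :: real assume e: "e > 0"
  have "compact {-?C..?C}" "continuous_on {-?C..?C} f" using f by (auto intro: continuous_on_subset)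
  from Stone_Weierstrass_real_polynomial_function[OF this e] obtain g where
    g: "real_polynomial_function g" "\<And>z. z \<in> {-?C..?C} \<Longrightarrow> \<bar>f z - g z\<bar> < e" by blast
  from g(1) obtain a n where gn: "g = (\<lambda>x. \<Sum>i\<le>n. a i * x ^ i)" by (auto simp: real_polynomial_function_iff_sum)
  have "girth_determined d (\<lambda>x. \<Sum>i\<le>m. a i * x ^ i)" for m
  proof (induction m)
    case 0
    show ?case using girth_determined_linear[OF girth_determined_power_resolvent(2)[OF d, of 0] girth_determined_power_resolvent(2)[OF d, of 0], of "a 0" 0] by simp
  next
    case (Suc m)
    show ?case using girth_determined_linear[OF Suc girth_determined_power_resolvent(2)[OF d, of "Suc m"], of 1 "a (Suc m)"] by simp
  qed
  then have "girth_determined d g" unfolding gn .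
  moreover have "\<bar>f z - g z\<bar> \<le> e" if "\<bar>z\<bar> \<le> ?C" for z
  proof -
    have "z \<in> {-?C..?C}" using that unfolding abs_le_iff atLeastAtMost_iff by linarith
    then show ?thesis using g(2) by (simp add: less_imp_le)
  qed
  ultimately show "\<exists>g. girth_determined d g \<and> (\<forall>z. \<bar>z\<bar> \<le> ?C \<longrightarrow> \<bar>f z - g z\<bar> \<le> e)" by blast
qed

section \<open>Matchings in 2-covers\<close>

text \<open>A bipartite multigraph of maximum degree two is properly 2-edge-colourable: contract a path of
  two edges meeting in a vertex on the \<open>q\<close>-side and colour what remains.\<close>
lemma two_edge_colouring:
  assumes "finite F"
    and "\<And>x y z. x \<in> F \<Longrightarrow> y \<in> F \<Longrightarrow> z \<in> F \<Longrightarrow> p x = p y \<Longrightarrow> p y = p z \<Longrightarrow> x = y \<or> y = z \<or> x = z"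
    and "\<And>x y z. x \<in> F \<Longrightarrow> y \<in> F \<Longrightarrow> z \<in> F \<Longrightarrow> q x = q y \<Longrightarrow> q y = q z \<Longrightarrow> x = y \<or> y = z \<or> x = z"
  shows "\<exists>c :: 'a \<Rightarrow> bool. \<forall>x\<in>F. \<forall>y\<in>F. x \<noteq> y \<and> (p x = p y \<or> q x = q y) \<longrightarrow> c x \<noteq> c y"
  using assms
proof (induction "card F" arbitrary: F p rule: less_induct)
  case (less F p)
  note P = less.prems(2) and Q = less.prems(3)
  show ?case
  proof (cases "inj_on q F")
    case True
    \<comment> \<open>Conflicts now arise only through \<open>p\<close>, whose classes have at most
      two members: colour by whether an edge is the chosen one of its class.\<close>
    define s where "s x = (SOME y. y \<in> F \<and> p y = p x)" for x
    have s: "s x \<in> F \<and> p (s x) = p x" if "x \<in> F" for x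
      unfolding s_def by (rule someI[of _ x]) (use that in simp)
    have "(x = s x) \<noteq> (y = s y)" if xy: "x \<in> F" "y \<in> F" "x \<noteq> y" "p x = p y \<or> q x = q y" for x y
    proof -
      have pxy: "p x = p y" using xy inj_onD[OF True] by auto
      then have "s x = s y" by (simp add: s_def)
      moreover have "s x = x \<or> s x = y" using P[of "s x" x y] s[OF xy(1)] xy pxy by auto
      ultimately show ?thesis using xy(3) by auto
    qed
    then show ?thesis by (intro exI[of _ "\<lambda>x. x = s x"]) blast
  next
    case False
    then obtain f g where fg: "f \<in> F" "g \<in> F" "f \<noteq> g" "q f = q g" by (auto simp: inj_on_def)
    define F' where "F' = F - {f, g}"
    \<comment> \<open>Merging the vertex \<open>p f\<close> into \<open>p g\<close> keeps degrees at
      most two: with \<open>f\<close> and \<open>g\<close> gone, at most one edge remains at each of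
      them, and none if they are equal.\<close>
    define p' where "p' x = (if p x = p f then p g else p x)" for x
    have sub: "\<And>x. x \<in> F' \<Longrightarrow> x \<in> F \<and> x \<noteq> f \<and> x \<noteq> g" by (simp add: F'_def)
    have no: "p x \<noteq> p f" "p x \<noteq> p g" if "x \<in> F'" "p f = p g" for x
      using P[of x f g] sub[OF that(1)] that(2) fg by auto
    have uf: "x = y" if "x \<in> F'" "y \<in> F'" "p x = p f" "p y = p f" for x y
      using P[of x y f] sub[OF that(1)] sub[OF that(2)] that fg by auto
    have ug: "x = y" if "x \<in> F'" "y \<in> F'" "p x = p g" "p y = p g" for x y
      using P[of x y g] sub[OF that(1)] sub[OF that(2)] that fg by auto
    have fc: "card F' < card F"
      unfolding F'_def by (rule psubset_card_mono) (use less.prems(1) fg in auto)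
    have ff: "finite F'" using less.prems(1) by (simp add: F'_def)
    have t1: "x = y \<or> y = z \<or> x = z"
      if xyz: "x \<in> F'" "y \<in> F'" "z \<in> F'" "p' x = p' y" "p' y = p' z" for x y z
    proof (cases "p' x = p g")
      case True
      then have "p x \<in> {p f, p g}" "p y \<in> {p f, p g}" "p z \<in> {p f, p g}"
        using xyz by (auto simp: p'_def split: if_splits)
      then show ?thesis using uf ug xyz(1-3) by (metis insertE singletonD)
    next
      case False
      then have "p x = p y" "p y = p z" using xyz by (auto simp: p'_def split: if_splits)
      then show ?thesis using P sub xyz(1-3) by blast
    qed
    have t2: "x = y \<or> y = z \<or> x = z"
      if "x \<in> F'" "y \<in> F'" "z \<in> F'" "q x = q y" "q y = q z" for x y z
      using Q sub that by blast
    obtain c :: "'a \<Rightarrow> bool" where c0: "\<forall>x\<in>F'. \<forall>y\<in>F'. x \<noteq> y \<and> (p' x = p' y \<or> q x = q y) \<longrightarrow> c x \<noteq> c y"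
      using less.hyps[OF fc ff t1 t2] by (rule exE)
    have c: "c x \<noteq> c y" if "x \<in> F'" "y \<in> F'" "x \<noteq> y" "p' x = p' y \<or> q x = q y" for x y
      using c0[rule_format, OF that(1,2)] that(3,4) by simp
    \<comment> \<open>\<open>b\<close> will be the colour of \<open>f\<close>, and \<open>g\<close>
      gets the other one. A remaining edge at \<open>p f\<close> and one at \<open>p g\<close> meet
      in the merged vertex, so their colours differ and both demands on \<open>b\<close>
      agree.\<close>
    obtain b where b: "\<And>x. x \<in> F' \<Longrightarrow> p x = p f \<Longrightarrow> c x \<noteq> b" "\<And>x. x \<in> F' \<Longrightarrow> p x = p g \<Longrightarrow> c x = b"
    proof (cases "\<exists>x\<in>F'. p x = p f")
      case True
      then obtain x where x: "x \<in> F'" "p x = p f" by blast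
      have ne: "p f \<noteq> p g" using no[OF x(1)] x(2) by auto
      have "c y = (\<not> c x)" if y: "y \<in> F'" "p y = p g" for y
      proof -
        have "x \<noteq> y" "p' x = p' y" using ne x y by (auto simp: p'_def)
        then show ?thesis using c[OF x(1) y(1)] by simp
      qed
      moreover have "c z \<noteq> (\<not> c x)" if "z \<in> F'" "p z = p f" for z
        using uf[OF that(1) x(1) that(2) x(2)] by simp
      ultimately show ?thesis using that[of "\<not> c x"] by simp
    next
      case nf: False
      show ?thesis
      proof (cases "\<exists>x\<in>F'. p x = p g")
        case True
        then obtain x where x: "x \<in> F'" "p x = p g" by blast
        have "c z = c x" if "z \<in> F'" "p z = p g" for z
          using ug[OF that(1) x(1) that(2) x(2)] by simp
        then show ?thesis using that[of "c x"] nf by simp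
      next
        case False
        then show ?thesis using that[of True] nf by simp
      qed
    qed
    define c' where "c' x = (if x = f then b else if x = g then \<not> b else c x)" for x
    have qn: "q x \<noteq> q f" if "x \<in> F'" for x
      using Q[of x f g] sub[OF that] fg by auto
    have cpq: "c x \<noteq> c y" if "x \<in> F'" "y \<in> F'" "x \<noteq> y" "p x = p y \<or> q x = q y" for x y
      by (rule c[OF that(1-3)]) (use that(4) in \<open>auto simp: p'_def\<close>)
    have "c' x \<noteq> c' y" if xy: "x \<in> F" "y \<in> F" "x \<noteq> y" "p x = p y \<or> q x = q y" for x y
    proof -
      have m: "z \<in> F' \<or> z = f \<or> z = g" if "z \<in> F" for z using that by (auto simp: F'_def)
      have cF: "c' z = c z" if "z \<in> F'" for z using sub[OF that] by (simp add: c'_def)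
      have cfg: "c' f = b" "c' g = (\<not> b)" using fg(3) by (auto simp: c'_def)
      show ?thesis
        using m[OF xy(1)] m[OF xy(2)] xy(3,4) cpq[of x y] b[of x] b[of y] qn[of x] qn[of y] cF[of x] cF[of y] cfg fg(4)
        by metis
    qed
    then show ?thesis by (intro exI[of _ c'] ballI impI) simp
  qed
qed

section \<open>The injection of matchings upstairs into pairs of matchings downstairs\<close>

text \<open>A 2-cover in terms of edges, with \<open>X\<close> upstairs and \<open>Y\<close>
  downstairs: lifts of one edge that meet are equal, and among three edges over a vertex
  \<open>v\<close> two must meet, as \<open>v\<close> has at most two lifts.\<close>

locale two_cover_edges =
  fixes X :: "'b set set" and Y :: "'a set set" and P :: "'b set \<Rightarrow> 'a set" and A :: "'a set"
  assumes fin: "finite X" "finite Y"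
    and proj: "\<And>e. e \<in> X \<Longrightarrow> P e \<in> Y"
    and locally_inj: "\<And>e f. e \<in> X \<Longrightarrow> f \<in> X \<Longrightarrow> P e = P f \<Longrightarrow> e \<inter> f \<noteq> {} \<Longrightarrow> e = f"
    and two_sheets: "\<And>e f g v. e \<in> X \<Longrightarrow> f \<in> X \<Longrightarrow> g \<in> X \<Longrightarrow> v \<in> P e \<Longrightarrow> v \<in> P f \<Longrightarrow> v \<in> P g
      \<Longrightarrow> e \<inter> f = {} \<Longrightarrow> e \<inter> g = {} \<Longrightarrow> f \<inter> g \<noteq> {}"
    and bip: "\<And>e. e \<in> Y \<Longrightarrow> \<exists>a b. e = {a, b} \<and> a \<in> A \<and> b \<notin> A"
begin

definition matchings_up :: "'b set set set" where
  "matchings_up = {M. M \<subseteq> X \<and> (\<forall>e\<in>M. \<forall>f\<in>M. e \<noteq> f \<longrightarrow> e \<inter> f = {})}"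

definition matchings_down :: "'a set set set" where
  "matchings_down = {M. M \<subseteq> Y \<and> (\<forall>e\<in>M. \<forall>f\<in>M. e \<noteq> f \<longrightarrow> e \<inter> f = {})}"

definition fibre :: "'b set set \<Rightarrow> 'a set \<Rightarrow> 'b set set" where
  "fibre M e = {x\<in>M. P x = e}"

definition profile :: "'b set set \<Rightarrow> 'a set \<Rightarrow> nat" where
  "profile M = (\<lambda>e. card (fibre M e))"

text \<open>The reference matching. It depends on \<open>M\<close> only through its profile, so that
  it can be recovered from the images.\<close>

definition rep :: "'b set set \<Rightarrow> 'b set set" where
  "rep M = (SOME M'. M' \<in> matchings_up \<and> profile M' = profile M)"

definition proper_colouring :: "'b set set \<Rightarrow> ('b set \<Rightarrow> bool) \<Rightarrow> bool" where
  "proper_colouring M c \<longleftrightarrow> (\<forall>x\<in>M. \<forall>y\<in>M. x \<noteq> y \<and> P x \<inter> P y \<noteq> {} \<longrightarrow> c x \<noteq> c y)"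

definition col :: "'b set set \<Rightarrow> 'b set \<Rightarrow> bool" where
  "col M = (SOME c. proper_colouring M c)"

text \<open>Constant along the components of the projection, by
  \<open>not_flipped_neighbour\<close>. Over an edge used once it means that \<open>M\<close> takes
  the other lift.\<close>

definition flipped :: "'b set set \<Rightarrow> 'a set \<Rightarrow> bool" where
  "flipped M e \<longleftrightarrow> fibre M e \<noteq> fibre (rep M) e"

text \<open>An exclusive or: the fixed colouring of the reference, with colours exchanged on the
  flipped components. It records which of its two lifts a component has in \<open>M\<close>.\<close>

definition sheet :: "'b set set \<Rightarrow> 'b set \<Rightarrow> bool" where
  "sheet M x \<longleftrightarrow> col (rep M) x \<noteq> flipped M (P x)"

definition push :: "'b set set \<Rightarrow> bool \<Rightarrow> 'a set set" where
  "push M b = P ` {x \<in> rep M. sheet M x = b}"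

lemma upD: "M \<in> matchings_up \<Longrightarrow> x \<in> M \<Longrightarrow> x \<in> X"
  by (auto simp: matchings_up_def)

lemma up_disjoint: "M \<in> matchings_up \<Longrightarrow> x \<in> M \<Longrightarrow> y \<in> M \<Longrightarrow> x \<noteq> y \<Longrightarrow> x \<inter> y = {}"
  by (auto simp: matchings_up_def)

lemma finite_up: "M \<in> matchings_up \<Longrightarrow> finite M"
  using fin finite_subset by (auto simp: matchings_up_def)

lemma finite_fibre: "M \<in> matchings_up \<Longrightarrow> finite (fibre M e)"
  using finite_up by (simp add: fibre_def)

lemma rep: assumes "M \<in> matchings_up" shows "rep M \<in> matchings_up" "profile (rep M) = profile M"
  using someI[of "\<lambda>M'. M' \<in> matchings_up \<and> profile M' = profile M" M] assms by (auto simp: rep_def)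

lemma card_profile: "M \<in> matchings_up \<Longrightarrow> card M = (\<Sum>e\<in>Y. profile M e)"
proof -
  assume M: "M \<in> matchings_up"
  have "card M = (\<Sum>x\<in>M. 1)" by simp
  also have "\<dots> = (\<Sum>e\<in>Y. \<Sum>x | x \<in> M \<and> P x = e. 1)"
    by (rule sum.group[symmetric]) (use finite_up[OF M] fin proj upD[OF M] in auto)
  finally show ?thesis by (simp add: profile_def fibre_def)
qed

lemma fibre_eqI:
  assumes "M \<in> matchings_up" "fibre (rep M) e \<subseteq> fibre M e"
  shows "\<not> flipped M e"
proof -
  have "card (fibre (rep M) e) = card (fibre M e)" using rep(2)[OF assms(1)] by (simp add: profile_def fun_eq_iff)
  then show ?thesis using card_subset_eq[OF finite_fibre[OF assms(1)] assms(2)] by (simp add: flipped_def)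
qed

lemma proj_mem: "e \<in> X \<Longrightarrow> \<exists>a b. P e = {a, b} \<and> a \<in> A \<and> b \<notin> A"
  using bip proj by blast

lemma three_sheets:
  assumes "M \<in> matchings_up" "x \<in> M" "y \<in> M" "z \<in> M" "v \<in> P x" "v \<in> P y" "v \<in> P z"
  shows "x = y \<or> y = z \<or> x = z"
  using two_sheets[of x y z v] up_disjoint[OF assms(1)] upD[OF assms(1)] assms(2-) by metis

text \<open>Bipartiteness splits each projected edge into an end \<open>p\<close> in
  \<open>A\<close> and an end \<open>q\<close> outside, so projections that meet agree in
  \<open>p\<close> or in \<open>q\<close>. Degrees are at most two by
  \<open>three_sheets\<close>.\<close>

lemma proper_colouring_exists:
  assumes M: "M \<in> matchings_up"
  shows "proper_colouring M (col M)"
proof -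
  obtain p q where pq: "\<And>x. x \<in> X \<Longrightarrow> P x = {p x, q x} \<and> p x \<in> A \<and> q x \<notin> A"
    using proj_mem by metis
  have "\<exists>c :: 'b set \<Rightarrow> bool. \<forall>x\<in>M. \<forall>y\<in>M. x \<noteq> y \<and> (p x = p y \<or> q x = q y) \<longrightarrow> c x \<noteq> c y"
  proof (rule two_edge_colouring[OF finite_up[OF M]])
    fix x y z assume xyz: "x \<in> M" "y \<in> M" "z \<in> M" "p x = p y" "p y = p z"
    show "x = y \<or> y = z \<or> x = z"
      by (rule three_sheets[OF M xyz(1-3), of "p x"]) (use xyz pq upD[OF M] in auto)
  next
    fix x y z assume xyz: "x \<in> M" "y \<in> M" "z \<in> M" "q x = q y" "q y = q z"
    show "x = y \<or> y = z \<or> x = z"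
      by (rule three_sheets[OF M xyz(1-3), of "q x"]) (use xyz pq upD[OF M] in auto)
  qed
  then obtain c :: "'b set \<Rightarrow> bool"
    where c: "\<forall>x\<in>M. \<forall>y\<in>M. x \<noteq> y \<and> (p x = p y \<or> q x = q y) \<longrightarrow> c x \<noteq> c y"
    by (rule exE)
  have "proper_colouring M c"
    unfolding proper_colouring_def
  proof (intro ballI impI)
    fix x y assume xy: "x \<in> M" "y \<in> M" "x \<noteq> y \<and> P x \<inter> P y \<noteq> {}"
    have "P x = {p x, q x} \<and> p x \<in> A \<and> q x \<notin> A" "P y = {p y, q y} \<and> p y \<in> A \<and> q y \<notin> A"
      by (rule pq[OF upD[OF M xy(1)]], rule pq[OF upD[OF M xy(2)]])
    then have "p x = p y \<or> q x = q y" using xy by auto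
    then show "c x \<noteq> c y" using c[rule_format, OF xy(1,2)] xy(3) by simp
  qed
  then show ?thesis unfolding col_def by (rule someI[where P = "proper_colouring M"])
qed

text \<open>Unflipped means that \<open>x\<close> lies in both matchings. Over \<open>P y\<close>
  each matching has an edge disjoint from \<open>x\<close>, and all three lie over \<open>v\<close>;
  so the two edges meet by \<open>two_sheets\<close> and coincide by
  \<open>locally_inj\<close>.\<close>

lemma not_flipped_neighbour:
  assumes M: "M \<in> matchings_up" and x: "x \<in> rep M" and y: "y \<in> rep M" and ne: "P x \<noteq> P y"
    and v: "v \<in> P x" "v \<in> P y" and nf: "\<not> flipped M (P x)"
  shows "\<not> flipped M (P y)"
proof (rule fibre_eqI[OF M], rule subsetI)
  fix y' assume "y' \<in> fibre (rep M) (P y)"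
  then have y': "y' \<in> rep M" "P y' = P y" by (auto simp: fibre_def)
  have "x \<in> fibre (rep M) (P x)" using x by (simp add: fibre_def)
  then have xM: "x \<in> M" using nf by (auto simp: flipped_def fibre_def)
  have "card (fibre M (P y)) = card (fibre (rep M) (P y))"
    using rep(2)[OF M] by (simp add: profile_def fun_eq_iff)
  moreover have "card (fibre (rep M) (P y)) > 0"
    using y finite_fibre[OF rep(1)[OF M]] by (auto simp: card_gt_0_iff fibre_def)
  ultimately have "fibre M (P y) \<noteq> {}" by auto
  then obtain f where f: "f \<in> M" "P f = P y" by (auto simp: fibre_def)
  have "x \<inter> y' = {}" using up_disjoint[OF rep(1)[OF M] x y'(1)] ne y' by auto
  moreover have "x \<inter> f = {}" using up_disjoint[OF M xM f(1)] ne f by auto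
  ultimately have "y' \<inter> f \<noteq> {}"
    using two_sheets[of x y' f v] upD[OF M] upD[OF rep(1)[OF M]] xM f y' v by auto
  then have "y' = f" using locally_inj[of y' f] upD[OF M] upD[OF rep(1)[OF M]] f y' by auto
  then show "y' \<in> fibre M (P y)" using f by (simp add: fibre_def)
qed

text \<open>The disjoint edges \<open>x\<close> and \<open>y\<close> exhaust the lifts of a common
  vertex, so every edge of \<open>M\<close> over \<open>P x\<close> meets one of them and equals
  it.\<close>

lemma not_flipped_double:
  assumes M: "M \<in> matchings_up" and x: "x \<in> rep M" and y: "y \<in> rep M" and ne: "x \<noteq> y" and e: "P x = P y"
  shows "\<not> flipped M (P x)"
proof -
  have "fibre M (P x) \<subseteq> fibre (rep M) (P x)"
  proof
    fix f assume "f \<in> fibre M (P x)"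
    then have f: "f \<in> M" "P f = P x" by (auto simp: fibre_def)
    obtain v where v: "v \<in> P x" using proj_mem[OF upD[OF rep(1)[OF M] x]] by auto
    have "x \<inter> y = {}" using up_disjoint[OF rep(1)[OF M] x y ne] .
    then have "x \<inter> f \<noteq> {} \<or> y \<inter> f \<noteq> {}"
      using two_sheets[of x y f v] upD[OF M] upD[OF rep(1)[OF M]] x y f v e by metis
    then have "f = x \<or> f = y"
      using locally_inj[of x f] locally_inj[of y f] upD[OF M] upD[OF rep(1)[OF M]] f x y e by auto
    then show "f \<in> fibre (rep M) (P x)" using x y e by (auto simp: fibre_def)
  qed
  moreover have "card (fibre M (P x)) = card (fibre (rep M) (P x))"
    using rep(2)[OF M] by (simp add: profile_def fun_eq_iff)
  ultimately have "fibre M (P x) = fibre (rep M) (P x)"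
    using card_subset_eq[OF finite_fibre[OF rep(1)[OF M]]] by blast
  then show ?thesis by (simp add: flipped_def)
qed

text \<open>Edges with meeting projections are flipped together, so the exchange of colours keeps
  the colouring proper.\<close>

lemma sheet_distinct:
  assumes M: "M \<in> matchings_up" and x: "x \<in> rep M" and y: "y \<in> rep M" and ne: "x \<noteq> y" and m: "P x \<inter> P y \<noteq> {}"
  shows "sheet M x \<noteq> sheet M y"
proof -
  have "col (rep M) x \<noteq> col (rep M) y"
    using proper_colouring_exists[OF rep(1)[OF M]] x y ne m by (auto simp: proper_colouring_def)
  moreover have "flipped M (P x) = flipped M (P y)"
    using not_flipped_neighbour[OF M x y] not_flipped_neighbour[OF M y x] m by (cases "P x = P y") auto
  ultimately show ?thesis by (auto simp: sheet_def)
qed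

lemma proj_nonempty: "x \<in> X \<Longrightarrow> P x \<noteq> {}"
  using proj_mem by blast

lemma push_matching: "M \<in> matchings_up \<Longrightarrow> push M b \<in> matchings_down"
  unfolding matchings_down_def push_def
  using sheet_distinct proj upD[OF rep(1)] by fastforce

lemma inj_on_push: "M \<in> matchings_up \<Longrightarrow> inj_on P {x \<in> rep M. sheet M x = b}"
proof (rule inj_onI, rule ccontr)
  fix x y assume M: "M \<in> matchings_up" and "x \<in> {x \<in> rep M. sheet M x = b}" "y \<in> {x \<in> rep M. sheet M x = b}"
    "P x = P y" "x \<noteq> y"
  then show False using sheet_distinct[OF M, of x y] proj_nonempty[of x] upD[OF rep(1)[OF M]] by auto
qed

lemma card_push:
  assumes M: "M \<in> matchings_up"
  shows "card (push M True) + card (push M False) = card M"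
proof -
  have "card (push M b) = card {x \<in> rep M. sheet M x = b}" for b
    unfolding push_def by (rule card_image[OF inj_on_push[OF M]])
  moreover have "card {x \<in> rep M. sheet M x = True} + card {x \<in> rep M. sheet M x = False} = card (rep M)"
  proof -
    have "card ({x \<in> rep M. sheet M x = True} \<union> {x \<in> rep M. sheet M x = False})
      = card {x \<in> rep M. sheet M x = True} + card {x \<in> rep M. sheet M x = False}"
      by (rule card_Un_disjoint) (use finite_up[OF rep(1)[OF M]] in auto)
    moreover have "{x \<in> rep M. sheet M x = True} \<union> {x \<in> rep M. sheet M x = False} = rep M" by auto
    ultimately show ?thesis by metis
  qed
  moreover have "card (rep M) = card M"
    using card_profile[OF M] card_profile[OF rep(1)[OF M]] rep(2)[OF M] by simp
  ultimately show ?thesis by simp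
qed

text \<open>Makes the profile, and with it the reference matching, readable from the two
  images.\<close>

lemma profile_push:
  assumes M: "M \<in> matchings_up"
  shows "profile M e = of_bool (e \<in> push M True) + of_bool (e \<in> push M False)"
proof -
  let ?F = "\<lambda>b. {x \<in> rep M. sheet M x = b \<and> P x = e}"
  have fin: "finite (rep M)" using finite_up[OF rep(1)[OF M]] .
  have c: "card (?F b) = of_bool (e \<in> push M b)" for b
  proof (cases "e \<in> push M b")
    case True
    then obtain x where "x \<in> ?F b" by (auto simp: push_def)
    moreover have "z = x" if "z \<in> ?F b" for z
      using inj_onD[OF inj_on_push[OF M, of b], of z x] that \<open>x \<in> ?F b\<close> by auto
    ultimately have "?F b = {x}" by blast
    then show ?thesis using True by simp
  next
    case False
    then have "?F b = {}" by (auto simp: push_def)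
    then show ?thesis by (simp only: card.empty False of_bool_eq)
  qed
  have "card (?F True \<union> ?F False) = card (?F True) + card (?F False)"
    by (rule card_Un_disjoint) (use fin in auto)
  moreover have "fibre (rep M) e = ?F True \<union> ?F False" by (auto simp: fibre_def)
  ultimately have "card (fibre (rep M) e) = card (?F True) + card (?F False)" by metis
  then show ?thesis using rep(2)[OF M] c[of True] c[of False] by (simp add: profile_def fun_eq_iff)
qed

text \<open>Decoding: the images give the profile and hence \<open>rep M\<close>; comparing sheets
  with the colouring of \<open>rep M\<close> gives \<open>flipped\<close>; and this gives
  \<open>M\<close>, since over a flipped edge the lift must be the one that \<open>rep M\<close>
  avoids. One inclusion suffices by symmetry.\<close>

lemma push_inj:
  assumes M: "M \<in> matchings_up" and M': "M' \<in> matchings_up" and eq: "\<And>b. push M b = push M' b"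
  shows "M \<subseteq> M'"
proof
  have prof: "profile M = profile M'" using profile_push[OF M] profile_push[OF M'] eq by auto
  then have R: "rep M' = rep M" by (simp add: rep_def)
  have flip: "flipped M (P x) = flipped M' (P x)" if x: "x \<in> rep M" for x
  proof -
    have "P x \<in> push M (sheet M x)" using x by (auto simp: push_def)
    then have "P x \<in> push M' (sheet M x)" using eq by simp
    then obtain y where y: "y \<in> rep M" "P y = P x" "sheet M' y = sheet M x" unfolding push_def R by auto
    show ?thesis
    proof (cases "y = x")
      case True
      then show ?thesis using y(3) by (auto simp: sheet_def R)
    next
      \<comment> \<open>Two reference edges have the same projection, and a doubled edge is never
        flipped.\<close>
      case False
      then show ?thesis
        using not_flipped_double[OF M x y(1)] not_flipped_double[OF M', of x y] x y R by auto
    qed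
  qed
  fix f assume f: "f \<in> M"
  then have "card (fibre M (P f)) > 0" using finite_fibre[OF M] by (auto simp: card_gt_0_iff fibre_def)
  then have pos: "card (fibre (rep M) (P f)) > 0" "card (fibre M' (P f)) > 0"
    using rep(2)[OF M] prof by (simp_all add: profile_def fun_eq_iff)
  then have "fibre (rep M) (P f) \<noteq> {}" "fibre M' (P f) \<noteq> {}" by auto
  then obtain x f' where x: "x \<in> rep M" "P x = P f" and f': "f' \<in> M'" "P f' = P f" by (auto simp: fibre_def)
  show "f \<in> M'"
  proof (cases "flipped M (P f)")
    case False
    then have "f \<in> fibre (rep M) (P f)" using f by (auto simp: flipped_def fibre_def)
    moreover have "\<not> flipped M' (P f)" using False flip[OF x(1)] x(2) by simp
    ultimately show ?thesis by (auto simp: flipped_def fibre_def R)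
  next
    case True
    then have T': "flipped M' (P f)" using flip[OF x(1)] x(2) by simp
    have single: "z = x" if "z \<in> rep M" "P z = P f" for z
      using not_flipped_double[OF M that(1) x(1)] x(2) that True by auto
    have X: "f \<in> X" "f' \<in> X" "x \<in> X" using f f' x upD M M' rep(1)[OF M] by auto
    obtain v where v: "v \<in> P f" using proj_nonempty[OF X(1)] by auto
    have fx: "f \<noteq> x"
    proof
      assume "f = x"
      then have "fibre (rep M) (P f) \<subseteq> fibre M (P f)" using single f by (auto simp: fibre_def)
      then show False using fibre_eqI[OF M] True by blast
    qed
    have f'x: "f' \<noteq> x"
    proof
      assume "f' = x"
      then have "fibre (rep M') (P f) \<subseteq> fibre M' (P f)" using single f' R by (auto simp: fibre_def)
      then show False using fibre_eqI[OF M'] T' by blast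
    qed
    \<comment> \<open>Both \<open>f\<close> and \<open>f'\<close> avoid the only reference edge
      \<open>x\<close> over \<open>P f\<close>, which leaves a single lift for them.\<close>
    have "x \<inter> f = {}" "x \<inter> f' = {}"
      using locally_inj[of x f] locally_inj[of x f'] X x f' fx f'x by auto
    then have "f \<inter> f' \<noteq> {}" using two_sheets[of x f f' v] X v x f' by auto
    then have "f = f'" using locally_inj[of f f'] X f' by auto
    then show ?thesis using f' by simp
  qed
qed

lemma sum_matchings_le:
  fixes t :: real
  assumes t: "t \<ge> 0"
  shows "(\<Sum>M\<in>matchings_up. t ^ card M) \<le> (\<Sum>N\<in>matchings_down. t ^ card N)\<^sup>2"
proof -
  let ?\<Phi> = "\<lambda>M. (push M True, push M False)"
  have inj: "inj_on ?\<Phi> matchings_up"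
  proof (rule inj_onI)
    fix M M' assume M: "M \<in> matchings_up" "M' \<in> matchings_up" and "?\<Phi> M = ?\<Phi> M'"
    then have "push M b = push M' b" for b by (cases b) auto
    then show "M = M'" using push_inj[OF M] push_inj[OF M(2,1)] by blast
  qed
  have "(\<Sum>M\<in>matchings_up. t ^ card M) = (\<Sum>M\<in>matchings_up. t ^ card (fst (?\<Phi> M)) * t ^ card (snd (?\<Phi> M)))"
    by (intro sum.cong) (auto simp: card_push power_add[symmetric])
  also have "\<dots> = (\<Sum>N\<in>?\<Phi> ` matchings_up. t ^ card (fst N) * t ^ card (snd N))"
    by (simp add: sum.reindex[OF inj])
  also have "\<dots> \<le> (\<Sum>N\<in>matchings_down \<times> matchings_down. t ^ card (fst N) * t ^ card (snd N))"
  proof (rule sum_mono2)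
    have "finite matchings_down" by (rule finite_subset[of _ "Pow Y"]) (use fin in \<open>auto simp: matchings_down_def\<close>)
    then show "finite (matchings_down \<times> matchings_down)" by simp
  qed (use push_matching t in auto)
  also have "\<dots> = (\<Sum>N\<in>matchings_down. t ^ card N)\<^sup>2"
    by (simp add: power2_eq_square sum_product sum.cartesian_product case_prod_beta)
  finally show ?thesis .
qed

end

text \<open>Injectivity on neighbourhoods becomes \<open>locally_inj\<close>, and fibres of at most
  two vertices become \<open>two_sheets\<close>.\<close>

definition two_cover :: "('b \<Rightarrow> 'a) \<Rightarrow> 'b set \<Rightarrow> ('b \<Rightarrow> 'b \<Rightarrow> bool) \<Rightarrow> 'a set \<Rightarrow> ('a \<Rightarrow> 'a \<Rightarrow> bool) \<Rightarrow> bool" where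
  "two_cover h V' E' V E \<longleftrightarrow> h ` V' \<subseteq> V \<and> (\<forall>x y. E' x y \<longrightarrow> E (h x) (h y))
    \<and> (\<forall>x y z. E' x y \<and> E' x z \<and> h y = h z \<longrightarrow> y = z)
    \<and> (\<forall>x\<in>V'. \<forall>y\<in>V'. \<forall>z\<in>V'. h x = h y \<and> h y = h z \<longrightarrow> x = y \<or> y = z \<or> x = z)"

theorem matching_gen_two_cover:
  assumes G: "fin_graph V E" and H: "fin_graph V' E'" and bip: "bipartite V E"
    and cov: "two_cover h V' E' V E" and t: "t \<ge> 0"
  shows "matching_gen V' E' t \<le> (matching_gen V E t)\<^sup>2"
proof -
  note E = fin_graph_simple[OF G] and E' = fin_graph_simple[OF H]
  obtain A where A: "\<And>u v. E u v \<Longrightarrow> (u \<in> A \<longleftrightarrow> v \<notin> A)" using bip by (auto simp: bipartite_def)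
  have c: "h ` V' \<subseteq> V" "\<And>x y. E' x y \<Longrightarrow> E (h x) (h y)"
    "\<And>x y z. E' x y \<Longrightarrow> E' x z \<Longrightarrow> h y = h z \<Longrightarrow> y = z"
    "\<And>x y z. x \<in> V' \<Longrightarrow> y \<in> V' \<Longrightarrow> z \<in> V' \<Longrightarrow> h x = h y \<Longrightarrow> h y = h z \<Longrightarrow> x = y \<or> y = z \<or> x = z"
    using cov unfolding two_cover_def by simp_all
  interpret two_cover_edges "edges V' E'" "edges V E" "\<lambda>e. h ` e" A
  proof
    show "finite (edges V' E')" "finite (edges V E)" using finite_edges fin_graph_finite G H by auto
    show "h ` e \<in> edges V E" if "e \<in> edges V' E'" for e
    proof -
      obtain a b where "e = {a, b}" "a \<in> V'" "b \<in> V'" "E' a b" using \<open>e \<in> edges V' E'\<close> by (auto simp: edges_def)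
      moreover from this have "h a \<in> V" "h b \<in> V" "E (h a) (h b)" using c(1,2) by auto
      ultimately show ?thesis by (auto simp: edges_def)
    qed
    show "e = f" if ef: "e \<in> edges V' E'" "f \<in> edges V' E'" "h ` e = h ` f" "e \<inter> f \<noteq> {}" for e f
    proof -
      obtain x where x: "x \<in> e" "x \<in> f" using ef(4) by auto
      obtain y where y: "e = {x, y}" "E' x y" using edgeE[OF E' ef(1) x(1)] by metis
      obtain z where z: "f = {x, z}" "E' x z" using edgeE[OF E' ef(2) x(2)] by metis
      have "h y \<noteq> h x" "h z \<noteq> h x" using simple_rel_irrefl[OF E c(2)[OF y(2)]] simple_rel_irrefl[OF E c(2)[OF z(2)]] by auto
      then have "h y = h z" using ef(3) y z by (auto simp: doubleton_eq_iff)
      then show ?thesis using c(3)[OF y(2) z(2)] y z by simp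
    qed
    show "f \<inter> g \<noteq> {}" if efg: "e \<in> edges V' E'" "f \<in> edges V' E'" "g \<in> edges V' E'"
      "v \<in> h ` e" "v \<in> h ` f" "v \<in> h ` g" "e \<inter> f = {}" "e \<inter> g = {}" for e f g v
    proof -
      obtain x y z where xyz: "x \<in> e" "y \<in> f" "z \<in> g" "h x = v" "h y = v" "h z = v" using efg by auto
      moreover have "x \<in> V'" "y \<in> V'" "z \<in> V'" using xyz efg edges_subset_Pow by blast+
      ultimately have "x = y \<or> y = z \<or> x = z" using c(4) by simp
      then show ?thesis using xyz efg by auto
    qed
    show "\<exists>a b. e = {a, b} \<and> a \<in> A \<and> b \<notin> A" if "e \<in> edges V E" for e
    proof -
      obtain a b where "e = {a, b}" "E a b" using \<open>e \<in> edges V E\<close> by (auto simp: edges_def)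
      then show ?thesis using A[of a b] by (metis insert_commute)
    qed
  qed
  have "{M. is_matching V' E' M} = matchings_up" "{M. is_matching V E M} = matchings_down"
    by (auto simp: is_matching_def matchings_up_def matchings_down_def)
  then show ?thesis using sum_matchings_le[OF t] by (simp add: matching_gen_def)
qed

section \<open>Covers of large girth\<close>

text \<open>Pushing matchings along an injective homomorphism is injective and keeps sizes. It
  serves to pass to isomorphic copies.\<close>

lemma matching_gen_embed:
  fixes t :: real
  assumes G: "fin_graph V E" and inj: "inj_on h V'" and sub: "h ` V' \<subseteq> V"
    and hom: "\<And>x y. E' x y \<Longrightarrow> E (h x) (h y)" and t: "t \<ge> 0"
  shows "matching_gen V' E' t \<le> matching_gen V E t"
proof -
  let ?P = "\<lambda>e. h ` e" and ?M' = "{M. is_matching V' E' M}"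
  have injP: "inj_on ?P (Pow V')" by (rule inj_on_image_Pow[OF inj])
  have edge: "edges V' E' \<subseteq> Pow V'" by (rule edges_subset_Pow)
  have M'sub: "?M' \<subseteq> Pow (Pow V')" using edge by (auto simp: is_matching_def)
  have injPP: "inj_on (\<lambda>M. ?P ` M) ?M'"
    by (rule inj_on_subset[OF inj_on_image_Pow[OF injP] M'sub])
  have card: "card (?P ` M) = card M" if "M \<in> ?M'" for M
    by (rule card_image[OF inj_on_subset[OF injP]]) (use that M'sub in auto)
  have match: "is_matching V E (?P ` M)" if M: "is_matching V' E' M" for M
    unfolding is_matching_def
  proof (intro conjI ballI impI)
    have "h ` e \<in> edges V E" if "e \<in> edges V' E'" for e
    proof -
      obtain a b where "e = {a, b}" "a \<in> V'" "b \<in> V'" "E' a b" using \<open>e \<in> edges V' E'\<close> by (auto simp: edges_def)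
      moreover from this have "h a \<in> V" "h b \<in> V" "E (h a) (h b)" using sub hom by auto
      ultimately show ?thesis by (auto simp: edges_def)
    qed
    then show "?P ` M \<subseteq> edges V E" using M by (auto simp: is_matching_def)
  next
    fix e f assume "e \<in> ?P ` M" "f \<in> ?P ` M" "e \<noteq> f"
    then obtain x y where xy: "x \<in> M" "y \<in> M" "e = h ` x" "f = h ` y" "x \<noteq> y" by auto
    then have "x \<inter> y = {}" "x \<subseteq> V'" "y \<subseteq> V'" using M edge by (auto simp: is_matching_def)
    then show "e \<inter> f = {}" unfolding xy(3,4) using inj_on_image_Int[OF inj, of x y] by simp
  qed
  have "matching_gen V' E' t = (\<Sum>M\<in>?M'. t ^ card (?P ` M))"
    unfolding matching_gen_def by (intro sum.cong refl) (use card in auto)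
  also have "\<dots> = (\<Sum>N\<in>(\<lambda>M. ?P ` M) ` ?M'. t ^ card N)"
    by (simp add: sum.reindex[OF injPP])
  also have "\<dots> \<le> matching_gen V E t"
    unfolding matching_gen_def
    by (rule sum_mono2) (use match t finite_matchings[OF fin_graph_finite[OF G], of E] in auto)
  finally show ?thesis .
qed

lemma has_cycle_embed:
  assumes "inj_on h V'" "h ` V' \<subseteq> V" "\<And>x y. E' x y \<Longrightarrow> E (h x) (h y)" "has_cycle_of_length V' E' k"
  shows "has_cycle_of_length V E k"
proof -
  obtain vs where vs: "k \<ge> 3" "length vs = k" "distinct vs" "set vs \<subseteq> V'" "\<forall>i<k. E' (vs ! i) (vs ! ((i + 1) mod k))"
    using assms(4) by (auto simp: has_cycle_of_length_def)
  have "E (map h vs ! i) (map h vs ! ((i + 1) mod k))" if "i < k" for i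
    using vs that assms(3) by simp
  moreover have "distinct (map h vs)" using vs inj_on_subset[OF assms(1)] by (simp add: distinct_map)
  moreover have "set (map h vs) \<subseteq> V" using vs(4) assms(2) by (simp only: set_map) blast
  ultimately show ?thesis
    unfolding has_cycle_of_length_def using vs(1,2) by (intro conjI exI[of _ "map h vs"]) auto
qed

text \<open>Each cover lives over a new vertex type, so an induction over iterated covers has to
  return to a fixed type; \<open>nat\<close> is the one that \<open>large_girth_seq\<close>
  uses.\<close>

lemma nat_copy:
  fixes V :: "'a set"
  assumes G: "fin_graph V E" "regular d V E" "bipartite V E" "girth_ge V E N"
  shows "\<exists>(V'::nat set) E'. fin_graph V' E' \<and> regular d V' E' \<and> bipartite V' E' \<and> girth_ge V' E' N
    \<and> card V' = card V \<and> (\<forall>t\<ge>0. matching_gen V' E' t \<le> matching_gen V E t)"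
proof -
  obtain f :: "'a \<Rightarrow> nat" where f: "inj_on f V"
    using finite_imp_inj_to_nat_seg[OF fin_graph_finite[OF G(1)]] by blast
  define E' where "E' x y \<longleftrightarrow> (\<exists>u v. E u v \<and> x = f u \<and> y = f v)" for x y
  define h where "h = inv_into V f"
  have V: "E u v \<Longrightarrow> u \<in> V \<and> v \<in> V" for u v using G(1) by (auto simp: fin_graph_def)
  have hf: "h (f u) = u" if "u \<in> V" for u using f that by (simp add: h_def)
  have hom: "E (h x) (h y)" if "E' x y" for x y using that V hf by (auto simp: E'_def)
  have sym: "E' y x" if "E' x y" for x y
    using that simple_rel_sym[OF fin_graph_simple[OF G(1)]] unfolding E'_def by blast
  have hinj: "inj_on h (f ` V)" using hf by (auto simp: inj_on_def)
  have hsub: "h ` f ` V \<subseteq> V" using hf by auto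
  have E'f: "E' (f u) (f v) \<longleftrightarrow> E u v" if "u \<in> V" "v \<in> V" for u v
    using hom[of "f u" "f v"] hf that by (auto simp: E'_def)
  have "fin_graph (f ` V) E'"
    unfolding fin_graph_def
  proof (intro conjI allI impI notI)
    show "finite (f ` V)" using fin_graph_finite[OF G(1)] by simp
    fix x assume "E' x x"
    then show False using hom simple_rel_irrefl[OF fin_graph_simple[OF G(1)]] by blast
  qed (use V sym in \<open>auto simp: E'_def\<close>)
  moreover have "regular d (f ` V) E'"
    unfolding regular_def
  proof
    fix x assume "x \<in> f ` V"
    then obtain v where v: "v \<in> V" "x = f v" by auto
    have "{y \<in> f ` V. E' x y} = f ` {u\<in>V. E v u}" using v E'f by auto
    moreover have "card (f ` {u\<in>V. E v u}) = card {u\<in>V. E v u}"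
      by (rule card_image[OF inj_on_subset[OF f]]) auto
    ultimately show "card {y \<in> f ` V. E' x y} = d" using G(2) v by (simp add: regular_def)
  qed
  moreover have "bipartite (f ` V) E'"
  proof -
    obtain A where A: "A \<subseteq> V" "\<And>u v. E u v \<Longrightarrow> (u \<in> A \<longleftrightarrow> v \<notin> A)" using G(3) by (auto simp: bipartite_def)
    have "f u \<in> f ` A \<longleftrightarrow> u \<in> A" if "u \<in> V" for u using inj_on_image_mem_iff[OF f that A(1)] .
    then have "x \<in> f ` A \<longleftrightarrow> y \<notin> f ` A" if "E' x y" for x y
      using that A(2) V unfolding E'_def by metis
    then show ?thesis unfolding bipartite_def using A(1) by (intro exI[of _ "f ` A"]) auto
  qed
  moreover have "girth_ge (f ` V) E' N"
    using has_cycle_embed[OF hinj hsub, of E' E] hom G(4) by (auto simp: girth_ge_def)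
  moreover have "card (f ` V) = card V" by (rule card_image[OF f])
  moreover have "matching_gen (f ` V) E' t \<le> matching_gen V E t" if "t \<ge> 0" for t
    by (rule matching_gen_embed[OF G(1) hinj hsub]) (use hom that in auto)
  ultimately show ?thesis by blast
qed

text \<open>The \<open>(\<int>/2)\<^sup>D\<close>-cover in which traversing an edge of \<open>D\<close> toggles its own coordinate. For \<open>D\<close>
  the set of all edges this is the universal cover with respect to homology modulo 2.\<close>
definition toggle :: "'a set set \<Rightarrow> 'a \<Rightarrow> 'a \<Rightarrow> 'a set set \<Rightarrow> 'a set set" where
  "toggle D u v S = {e \<in> D. (e \<in> S) \<noteq> (e = {u, v})}"

definition toggle_rel :: "('a \<Rightarrow> 'a \<Rightarrow> bool) \<Rightarrow> 'a set set \<Rightarrow> 'a \<times> 'a set set \<Rightarrow> 'a \<times> 'a set set \<Rightarrow> bool" where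
  "toggle_rel E D x y \<longleftrightarrow> E (fst x) (fst y) \<and> snd x \<subseteq> D \<and> snd y = toggle D (fst x) (fst y) (snd x)"

lemma toggle_toggle: "S \<subseteq> D \<Longrightarrow> toggle D v u (toggle D u v S) = S"
  by (auto simp: toggle_def insert_commute)

lemma toggle_subset: "toggle D u v S \<subseteq> D"
  by (auto simp: toggle_def)

lemma fin_graph_toggle:
  assumes G: "fin_graph V E" and D: "finite D"
  shows "fin_graph (V \<times> Pow D) (toggle_rel E D)"
  using assms toggle_subset[of D]
  unfolding fin_graph_def toggle_rel_def by (auto simp: toggle_toggle)

lemma regular_toggle:
  assumes "regular d V E"
  shows "regular d (V \<times> Pow D) (toggle_rel E D)"
  unfolding regular_def
proof
  fix x assume "x \<in> V \<times> Pow D"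
  then obtain u S where x: "x = (u, S)" "u \<in> V" "S \<subseteq> D" by auto
  have "{y \<in> V \<times> Pow D. toggle_rel E D x y} = (\<lambda>v. (v, toggle D u v S)) ` {v\<in>V. E u v}"
    using x by (auto simp: toggle_rel_def dest: subsetD[OF toggle_subset])
  moreover have "card \<dots> = card {v\<in>V. E u v}" by (rule card_image) (auto simp: inj_on_def)
  ultimately show "card {y \<in> V \<times> Pow D. toggle_rel E D x y} = d" using assms x by (simp add: regular_def)
qed

lemma bipartite_toggle:
  assumes "bipartite V E"
  shows "bipartite (V \<times> Pow D) (toggle_rel E D)"
proof -
  obtain A where A: "A \<subseteq> V" "\<And>u v. E u v \<Longrightarrow> (u \<in> A \<longleftrightarrow> v \<notin> A)" using assms by (auto simp: bipartite_def)
  then show ?thesis unfolding bipartite_def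
    by (intro exI[of _ "A \<times> Pow D"]) (use toggle_subset[of D] in \<open>auto simp: toggle_rel_def\<close>)
qed

text \<open>The covering map forgets the coordinate \<open>e\<close>: a fibre holds a set with and
  without \<open>e\<close>, and a neighbour is determined by its vertex, since the toggled set is
  forced. The full cover is thus a tower of 2-covers.\<close>

lemma two_cover_toggle:
  assumes e: "e \<notin> D"
  shows "two_cover (\<lambda>x. (fst x, snd x - {e})) (V \<times> Pow (insert e D)) (toggle_rel E (insert e D))
    (V \<times> Pow D) (toggle_rel E D)"
  unfolding two_cover_def
proof (intro conjI allI impI ballI)
  fix x y :: "'a \<times> 'a set set" assume xy: "toggle_rel E (insert e D) x y"
  show "toggle_rel E D (fst x, snd x - {e}) (fst y, snd y - {e})"
    using xy e by (auto simp: toggle_rel_def toggle_def)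
next
  fix x y z :: "'a \<times> 'a set set"
  assume "toggle_rel E (insert e D) x y \<and> toggle_rel E (insert e D) x z \<and> (fst y, snd y - {e}) = (fst z, snd z - {e})"
  then show "y = z" by (auto simp: toggle_rel_def prod_eq_iff)
next
  fix x y z :: "'a \<times> 'a set set"
  assume "(fst x, snd x - {e}) = (fst y, snd y - {e}) \<and> (fst y, snd y - {e}) = (fst z, snd z - {e})"
  then have "fst x = fst y" "fst y = fst z" "snd x - {e} = snd y - {e}" "snd y - {e} = snd z - {e}" by auto
  moreover have "S = T \<or> T = U \<or> S = U" if "S - {e} = T - {e}" "T - {e} = U - {e}" for S T U :: "'a set set"
    using that by (cases "e \<in> S"; cases "e \<in> T"; cases "e \<in> U") (metis Diff_empty Diff_insert0 insert_Diff)+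
  ultimately show "x = y \<or> y = z \<or> x = z" by (metis prod_eq_iff)
qed auto

lemma matching_gen_nonneg: "t \<ge> 0 \<Longrightarrow> matching_gen V E t \<ge> 0"
  by (auto simp: matching_gen_def intro!: sum_nonneg)

text \<open>Each edge added to \<open>D\<close> is one more 2-cover and squares the bound; for empty
  \<open>D\<close> the cover is a copy of the base graph.\<close>

lemma matching_gen_toggle_le:
  assumes G: "fin_graph V E" "bipartite V E" and t: "t \<ge> 0" and D: "finite D"
  shows "matching_gen (V \<times> Pow D) (toggle_rel E D) t \<le> matching_gen V E t ^ (2 ^ card D)"
  using D
proof (induction D rule: finite_induct)
  case empty
  have "matching_gen (V \<times> Pow {}) (toggle_rel E {}) t \<le> matching_gen V E t"
    by (rule matching_gen_embed[OF G(1), of fst]) (use t in \<open>auto simp: inj_on_def toggle_rel_def\<close>)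
  then show ?case by simp
next
  case (insert e D)
  have "matching_gen (V \<times> Pow (insert e D)) (toggle_rel E (insert e D)) t
    \<le> (matching_gen (V \<times> Pow D) (toggle_rel E D) t)\<^sup>2"
    by (rule matching_gen_two_cover[OF fin_graph_toggle[OF G(1)] fin_graph_toggle[OF G(1)] bipartite_toggle[OF G(2)]
      two_cover_toggle t]) (use insert.hyps in auto)
  also have "\<dots> \<le> (matching_gen V E t ^ (2 ^ card D))\<^sup>2"
    by (rule power_mono[OF insert.IH matching_gen_nonneg[OF t]])
  also have "\<dots> = matching_gen V E t ^ (2 ^ card (insert e D))"
    using insert.hyps by (simp add: power_mult[symmetric] mult.commute)
  finally show ?case .
qed

text \<open>A shortest closed segment of the projected walk is a cycle, so the projected walk is injective;
  its first edge is then toggled exactly once, which contradicts closedness of the lifted walk.\<close>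
lemma no_short_cycle_toggle:
  assumes G: "fin_graph V E" and g: "girth_ge V E k"
  shows "\<not> has_cycle_of_length (V \<times> Pow (edges V E)) (toggle_rel E (edges V E)) k"
proof
  let ?D = "edges V E"
  note E = fin_graph_simple[OF G]
  assume "has_cycle_of_length (V \<times> Pow ?D) (toggle_rel E ?D) k"
  then obtain vs where vs: "k \<ge> 3" "length vs = k" "distinct vs" "set vs \<subseteq> V \<times> Pow ?D"
    "\<And>i. i < k \<Longrightarrow> toggle_rel E ?D (vs ! i) (vs ! ((i + 1) mod k))"
    by (auto simp: has_cycle_of_length_def)
  define w where "w i = fst (vs ! i)" for i
  define S where "S i = snd (vs ! i)" for i
  have "vs ! i \<in> V \<times> Pow ?D" if "i < k" for i using vs(2,4) that by (metis nth_mem subsetD)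
  then have wV: "w i \<in> V" and SD: "S i \<subseteq> ?D" if "i < k" for i
    using that by (auto simp: w_def S_def mem_Times_iff)
  have step: "E (w i) (w (Suc i))" "S (Suc i) = toggle ?D (w i) (w (Suc i)) (S i)" if "Suc i < k" for i
    using vs(5)[of i] that by (auto simp: toggle_rel_def w_def S_def)
  have winj: "w i \<noteq> w j" if ij: "i < j" "j < k" for i j
  proof
    assume eq: "w i = w j"
    define Q where "Q m \<longleftrightarrow> m > 0 \<and> (\<exists>i. i + m < k \<and> w i = w (i + m))" for m
    have "Q (j - i)" unfolding Q_def using ij eq by (intro conjI exI[of _ i]) auto
    define m where "m = (LEAST m. Q m)"
    have "Q m" unfolding m_def by (rule LeastI[of Q, OF \<open>Q (j - i)\<close>])
    then obtain a where a: "m > 0" "a + m < k" "w a = w (a + m)" by (auto simp: Q_def)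
    have least: "\<not> Q m'" if "m' < m" for m' using that not_less_Least unfolding m_def by blast
    have "m \<noteq> 1"
    proof
      assume "m = 1"
      then show False using a step(1)[of a] simple_rel_irrefl[OF E] by auto
    qed
    \<comment> \<open>Stepping along an edge and straight back toggles it twice and returns to the
      same vertex of the cover, against distinctness of \<open>vs\<close>.\<close>
    moreover have "m \<noteq> 2"
    proof
      assume m: "m = 2"
      then have "S (Suc (Suc a)) = S a"
        using step(2)[of a] step(2)[of "Suc a"] a SD[of a] toggle_toggle[of "S a" ?D "w (Suc a)" "w a"] by auto
      then have "vs ! (Suc (Suc a)) = vs ! a" using a m by (simp add: w_def S_def prod_eq_iff)
      then show False using nth_eq_iff_index_eq[OF vs(3)] a m vs(2) by auto
    qed
    ultimately have m3: "m \<ge> 3" using a(1) by linarith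
    let ?c = "map (\<lambda>i. w (a + i)) [0..<m]"
    have "w (a + i) \<noteq> w (a + j)" if "i < j" "j < m" for i j
    proof
      assume "w (a + i) = w (a + j)"
      then have "Q (j - i)" unfolding Q_def using that a by (intro conjI exI[of _ "a + i"]) auto
      then show False using least[of "j - i"] that by auto
    qed
    then have "distinct ?c" by (auto simp: distinct_conv_nth) (metis linorder_neqE_nat)
    moreover have "set ?c \<subseteq> V" using wV a by auto
    moreover have "E (?c ! i) (?c ! ((i + 1) mod m))" if "i < m" for i
    proof (cases "Suc i = m")
      case True
      then show ?thesis using step(1)[of "a + i"] a by auto
    next
      case False
      then show ?thesis using step(1)[of "a + i"] a that by auto
    qed
    ultimately have "has_cycle_of_length V E m"
      unfolding has_cycle_of_length_def using m3 by (intro conjI exI[of _ ?c]) auto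
    then show False using g a by (auto simp: girth_ge_def)
  qed
  let ?e = "{w 0, w 1}"
  have e: "?e \<in> ?D" using step(1)[of 0] wV[of 0] wV[of 1] vs(1) by (auto simp: edges_def)
  have w01: "w 0 \<noteq> w 1" using winj[of 0 1] vs(1) by auto
  have mem: "?e \<in> S (Suc i) \<longleftrightarrow> (?e \<in> S 0) \<noteq> True" if "Suc i < k" for i
    using that
  proof (induction i)
    case 0
    then show ?case using step(2)[of 0] e by (auto simp: toggle_def)
  next
    case (Suc i)
    have "?e \<noteq> {w (Suc i), w (Suc (Suc i))}" using winj[of 0 "Suc i"] winj[of 0 "Suc (Suc i)"] Suc.prems by auto
    then show ?case using Suc step(2)[of "Suc i"] e by (auto simp: toggle_def)
  qed
  obtain l where l: "k = Suc (Suc l)" "l > 0" using vs(1) by (metis One_nat_def Suc_le_D Suc_le_lessD numeral_3_eq_3 Suc_le_mono)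
  have last: "S 0 = toggle ?D (w (Suc l)) (w 0) (S (Suc l))"
    using vs(5)[of "Suc l"] l by (simp add: toggle_rel_def w_def S_def)
  \<comment> \<open>The closing edge differs from the first one because \<open>w\<close> is
    injective and \<open>k\<close> is at least 3.\<close>
  have "?e \<noteq> {w (Suc l), w 0}" using winj[of 1 "Suc l"] winj[of 0 "Suc l"] l w01 by (auto simp: doubleton_eq_iff)
  then have "?e \<in> S 0 \<longleftrightarrow> ?e \<in> S (Suc l)" using e by (subst last) (auto simp: toggle_def)
  then show False using mem[of l] l by auto
qed

text \<open>Each round takes the full homology cover of the previous graph and excludes one further
  cycle length. The number of vertices grows by \<open>2 ^ card ?D\<close>, the exponent in
  \<open>matching_gen_toggle_le\<close>, so the normalised logarithm does not grow.\<close>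

lemma large_girth_cover:
  fixes V :: "'a set"
  assumes G: "fin_graph V E" "V \<noteq> {}" "regular d V E" "bipartite V E"
  shows "\<exists>(V'::nat set) E'. fin_graph V' E' \<and> V' \<noteq> {} \<and> regular d V' E' \<and> bipartite V' E' \<and> girth_ge V' E' N
    \<and> (\<forall>t\<ge>0. ln (matching_gen V' E' t) / real (card V') \<le> ln (matching_gen V E t) / real (card V))"
proof (induction N)
  case 0
  have "girth_ge V E 0" by (simp add: girth_ge_def)
  from nat_copy[OF G(1,3,4) this] obtain V' :: "nat set" and E' where
    V': "fin_graph V' E'" "regular d V' E'" "bipartite V' E'" "girth_ge V' E' 0" "card V' = card V"
      "\<And>t. t \<ge> 0 \<Longrightarrow> matching_gen V' E' t \<le> matching_gen V E t" by blast
  have ne: "V' \<noteq> {}" using V'(5) G(2) fin_graph_finite[OF G(1)] by auto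
  have "ln (matching_gen V' E' t) / real (card V') \<le> ln (matching_gen V E t) / real (card V)" if t: "t \<ge> 0" for t
    unfolding V'(5) using V'(6)[OF t] matching_gen_ge_1[OF fin_graph_finite[OF V'(1)] t, of E']
    by (intro divide_right_mono) auto
  then show ?case using V' ne by blast
next
  case (Suc N)
  then obtain V1 :: "nat set" and E1 where
    V1: "fin_graph V1 E1" "V1 \<noteq> {}" "regular d V1 E1" "bipartite V1 E1" "girth_ge V1 E1 N"
      "\<And>t. t \<ge> 0 \<Longrightarrow> ln (matching_gen V1 E1 t) / real (card V1) \<le> ln (matching_gen V E t) / real (card V)"
    by blast
  let ?D = "edges V1 E1"
  let ?V2 = "V1 \<times> Pow ?D" and ?E2 = "toggle_rel E1 ?D"
  have fD: "finite ?D" using finite_edges fin_graph_finite[OF V1(1)] by blast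
  have "girth_ge ?V2 ?E2 (Suc N)"
    unfolding girth_ge_def
  proof (intro allI impI)
    fix k assume "k < Suc N"
    then show "\<not> has_cycle_of_length ?V2 ?E2 k"
      by (intro no_short_cycle_toggle V1(1) girth_ge_mono[OF V1(5)]) auto
  qed
  from nat_copy[OF fin_graph_toggle[OF V1(1) fD] regular_toggle[OF V1(3)] bipartite_toggle[OF V1(4)] this]
  obtain V' :: "nat set" and E' where
    V': "fin_graph V' E'" "regular d V' E'" "bipartite V' E'" "girth_ge V' E' (Suc N)" "card V' = card ?V2"
      "\<And>t. t \<ge> 0 \<Longrightarrow> matching_gen V' E' t \<le> matching_gen ?V2 ?E2 t" by blast
  have c: "card V' = card V1 * 2 ^ card ?D" using V'(5) fD by (simp add: card_cartesian_product card_Pow)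
  have c1: "card V1 > 0" using V1(2) fin_graph_finite[OF V1(1)] by (simp add: card_gt_0_iff)
  have ne: "V' \<noteq> {}" using c c1 by auto
  have "ln (matching_gen V' E' t) / real (card V') \<le> ln (matching_gen V E t) / real (card V)" if t: "t \<ge> 0" for t
  proof -
    have g: "matching_gen V' E' t \<ge> 1" "matching_gen V1 E1 t \<ge> 1"
      using matching_gen_ge_1 fin_graph_finite V'(1) V1(1) t by blast+
    have "matching_gen V' E' t \<le> matching_gen V1 E1 t ^ (2 ^ card ?D)"
      using V'(6)[OF t] matching_gen_toggle_le[OF V1(1,4) t fD] by linarith
    then have "ln (matching_gen V' E' t) \<le> ln (matching_gen V1 E1 t ^ (2 ^ card ?D))"
      using g by (subst ln_le_cancel_iff) auto
    also have "\<dots> = 2 ^ card ?D * ln (matching_gen V1 E1 t)" using g by (simp add: ln_realpow)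
    finally have "ln (matching_gen V' E' t) / real (card V') \<le> 2 ^ card ?D * ln (matching_gen V1 E1 t) / real (card V')"
      by (rule divide_right_mono) simp
    also have "\<dots> = ln (matching_gen V1 E1 t) / real (card V1)" unfolding c by simp
    also have "\<dots> \<le> ln (matching_gen V E t) / real (card V)" by (rule V1(6)[OF t])
    finally show ?thesis .
  qed
  then show ?case using V' ne by blast
qed

section \<open>The limit measure\<close>

text \<open>Both sequences end up close to the same constant \<open>c\<close> given by
  \<open>girth_determined\<close>, so a limit along a subsequence of one fixes the limit of the
  other.\<close>

lemma girth_determined_limit:
  assumes f: "girth_determined d f"
    and G: "large_girth_seq d Vs Es" and G': "large_girth_seq d Vs' Es'"
    and s: "strict_mono (s :: nat \<Rightarrow> nat)"
    and lim: "(\<lambda>i. root_average (Vs (s i)) (Es (s i)) f) \<longlonglongrightarrow> L"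
  shows "(\<lambda>i. root_average (Vs' i) (Es' i) f) \<longlonglongrightarrow> L"
proof (rule LIMSEQ_I)
  fix e :: real assume e: "e > 0"
  then obtain N c where N: "\<And>(V::nat set) E. fin_graph V E \<Longrightarrow> V \<noteq> {} \<Longrightarrow> regular d V E \<Longrightarrow> girth_ge V E N
     \<Longrightarrow> \<bar>root_average V E f - c\<bar> \<le> e / 4"
    using f unfolding girth_determined_def by (meson zero_less_divide_iff zero_less_numeral)
  have near: "eventually (\<lambda>i. \<bar>root_average (Ws i) (Fs i) f - c\<bar> \<le> e / 4) sequentially"
    if "large_girth_seq d Ws Fs" for Ws Fs
  proof -
    have "eventually (\<lambda>i. girth_ge (Ws i) (Fs i) N) sequentially"
      using that by (simp add: large_girth_seq_def)
    then show ?thesis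
      by (rule eventually_mono) (use that in \<open>intro N, simp_all add: large_girth_seq_def\<close>)
  qed
  have "eventually (\<lambda>i. \<bar>root_average (Vs (s i)) (Es (s i)) f - c\<bar> \<le> e / 4) sequentially"
    using eventually_subseq[OF s near[OF G]] by simp
  moreover have "eventually (\<lambda>i. \<bar>root_average (Vs (s i)) (Es (s i)) f - L\<bar> < e / 4) sequentially"
    using tendstoD[OF lim, of "e / 4"] e by (simp add: dist_real_def)
  ultimately have "eventually (\<lambda>i. \<bar>L - c\<bar> < e / 2) sequentially"
    by eventually_elim linarith
  then have Lc: "\<bar>L - c\<bar> < e / 2" by simp
  have "eventually (\<lambda>i. norm (root_average (Vs' i) (Es' i) f - L) < e) sequentially"
    using near[OF G'] by eventually_elim (use Lc e in \<open>simp add: abs_if split: if_splits\<close>)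
  then show "\<exists>no. \<forall>n\<ge>no. norm (root_average (Vs' n) (Es' n) f - L) < e"
    by (simp add: eventually_sequentially)
qed

lemma tight_matching_measures:
  assumes G: "\<And>i. fin_graph (Vs i) (Es i)" "\<And>i. Vs i \<noteq> {}" "\<And>i. regular d (Vs i) (Es i)"
  shows "tight (\<lambda>i. matching_measure (Vs i) (Es i))"
proof -
  let ?C = "2 * real d + 2"
  \<comment> \<open>The interval is open on the left, so it starts one below the lower bound
    \<open>- ?C\<close> on the zeros.\<close>
  have "measure (matching_measure (Vs i) (Es i)) {- ?C - 1<..?C} = 1" for i
  proof -
    interpret real_distribution "matching_measure (Vs i) (Es i)"
      by (rule real_distribution_matching_measure[OF G(1,2)])
    have "prob {- ?C - 1<..?C} = (\<integral>z. indicat_real {- ?C - 1<..?C} z \<partial>matching_measure (Vs i) (Es i))"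
      by simp
    also have "\<dots> = root_average (Vs i) (Es i) (indicat_real {- ?C - 1<..?C})"
      by (rule integral_matching_measure[OF G(1)]) simp
    also have "\<dots> = root_average (Vs i) (Es i) (\<lambda>_. 1)"
      by (rule root_average_cong[OF G(1) regular_max_degree[OF G(3)]]) (auto simp: indicator_def abs_le_iff)
    also have "\<dots> = 1"
      using size_proots_matching_poly[OF G(1)] G(2) fin_graph_finite[OF G(1)] by (simp add: root_average_def)
    finally show ?thesis .
  qed
  then show ?thesis
    unfolding tight_def using real_distribution_matching_measure[OF G(1,2)]
    by (intro conjI allI impI exI[of _ "- ?C - 1"] exI[of _ ?C]) auto
qed

text \<open>Cosine and sine are bounded continuous test functions, so the characteristic functions
  agree and Levy's uniqueness theorem applies.\<close>

lemma real_distribution_eqI: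
  assumes M: "real_distribution M" and M': "real_distribution M'"
    and eq: "\<And>f. bounded_continuous_fun f \<Longrightarrow> (\<integral>z. f z \<partial>M) = (\<integral>z. f z \<partial>M')"
  shows "M = M'"
proof (rule Levy_uniqueness[OF M M'], rule ext)
  fix t
  have int: "Re (char N t) = (\<integral>z. cos (t * z) \<partial>N)" "Im (char N t) = (\<integral>z. sin (t * z) \<partial>N)"
    if "real_distribution N" for N
  proof -
    interpret real_distribution N by fact
    have i: "integrable N (\<lambda>x. iexp (t * x))" by (rule integrable_iexp) auto
    show "Re (char N t) = (\<integral>z. cos (t * z) \<partial>N)"
      unfolding char_def integral_Re[OF i, symmetric] by (simp add: Re_exp)
    show "Im (char N t) = (\<integral>z. sin (t * z) \<partial>N)"
      unfolding char_def integral_Im[OF i, symmetric] by (simp add: Im_exp)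
  qed
  have "bounded_continuous_fun (\<lambda>z. cos (t * z))" "bounded_continuous_fun (\<lambda>z. sin (t * z))"
    unfolding bounded_continuous_fun_def bounded_iff
    by (auto intro!: continuous_intros exI[of _ 1])
  then show "char M t = char M' t"
    using int[OF M] int[OF M'] eq by (simp add: complex_eq_iff)
qed

lemma integral_matching_measure_continuous:
  assumes "fin_graph V E" "continuous_on UNIV f"
  shows "(\<integral>z. f z \<partial>matching_measure V E) = root_average V E f"
  using assms by (intro integral_matching_measure borel_measurable_continuous_onI)

text \<open>Helly's theorem yields a limit only along a subsequence;
  \<open>girth_determined_limit\<close> upgrades it to all sequences of large girth. Testing on the
  given sequence yields the uniqueness that the definite description in \<open>rho_tree\<close>
  requires.\<close>

lemma rho_tree_limit:
  assumes d: "d \<ge> 1" and G: "large_girth_seq d Vs Es"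
  shows "real_distribution (rho_tree d)" "weak_converges (\<lambda>i. matching_measure (Vs i) (Es i)) (rho_tree d)"
proof -
  have fg: "fin_graph (Ws i) (Fs i)" if "large_girth_seq d Ws Fs" for Ws Fs i
    using that by (simp add: large_girth_seq_def)
  have G1: "fin_graph (Vs i) (Es i)" "Vs i \<noteq> {}" "regular d (Vs i) (Es i)" for i
    using G by (auto simp: large_girth_seq_def)
  have dist: "real_distribution (matching_measure (Vs i) (Es i))" for i
    by (rule real_distribution_matching_measure[OF G1(1,2)])
  obtain r M where r: "strict_mono (r :: nat \<Rightarrow> nat)" and M: "real_distribution M"
    and "weak_conv_m ((\<lambda>i. matching_measure (Vs i) (Es i)) \<circ> id \<circ> r) M"
    using tight_imp_convergent_subsubsequence[OF tight_matching_measures[of Vs Es d], of id] G1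
    by (auto simp: strict_mono_def)
  then have wc: "weak_conv_m (\<lambda>i. matching_measure (Vs (r i)) (Es (r i))) M" by (simp add: comp_def)
  interpret M: real_distribution M by fact
  have conv: "weak_converges (\<lambda>i. matching_measure (Ws i) (Fs i)) M" if W: "large_girth_seq d Ws Fs" for Ws Fs
    unfolding weak_converges_def
  proof (intro allI impI)
    fix f assume f: "bounded_continuous_fun f"
    then have cont: "continuous_on UNIV f" by (simp add: bounded_continuous_fun_def)
    from f obtain B where B: "\<And>x. norm (f x) \<le> B" by (auto simp: bounded_continuous_fun_def bounded_iff)
    have "(\<lambda>i. \<integral>z. f z \<partial>matching_measure (Vs (r i)) (Es (r i))) \<longlonglongrightarrow> (\<integral>z. f z \<partial>M)"
      by (rule weak_conv_imp_integral_bdd_continuous_conv[OF dist M wc _ B])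
        (use cont in \<open>simp add: continuous_on_eq_continuous_at\<close>)
    then have "(\<lambda>i. root_average (Vs (r i)) (Es (r i)) f) \<longlonglongrightarrow> (\<integral>z. f z \<partial>M)"
      by (simp add: integral_matching_measure_continuous[OF G1(1) cont])
    from girth_determined_limit[OF girth_determined_continuous[OF d cont] G W r this]
    show "(\<lambda>i. \<integral>z. f z \<partial>matching_measure (Ws i) (Fs i)) \<longlonglongrightarrow> (\<integral>z. f z \<partial>M)"
      by (simp add: integral_matching_measure_continuous[OF fg[OF W] cont])
  qed
  have "rho_tree d = M"
    unfolding rho_tree_def
  proof (rule the_equality)
    show "sets M = sets borel \<and> prob_space M \<and>
      (\<forall>Vs Es. large_girth_seq d Vs Es \<longrightarrow> weak_converges (\<lambda>i. matching_measure (Vs i) (Es i)) M)"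
      using conv M.prob_space_axioms by simp
  next
    fix M' assume M': "sets M' = sets borel \<and> prob_space M' \<and>
      (\<forall>Vs Es. large_girth_seq d Vs Es \<longrightarrow> weak_converges (\<lambda>i. matching_measure (Vs i) (Es i)) M')"
    show "M' = M"
    proof (rule real_distribution_eqI)
      show "real_distribution M'" using M' by (simp add: real_distribution_def real_distribution_axioms_def)
      show "real_distribution M" by fact
      fix f assume "bounded_continuous_fun f"
      then show "(\<integral>z. f z \<partial>M') = (\<integral>z. f z \<partial>M)"
        using M' conv[OF G] G LIMSEQ_unique unfolding weak_converges_def by blast
    qed
  qed
  then show "real_distribution (rho_tree d)" "weak_converges (\<lambda>i. matching_measure (Vs i) (Es i)) (rho_tree d)"
    using M conv[OF G] by simp_all
qed

lemma root_average_mono: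
  assumes "\<And>z. f z \<le> g z"
  shows "root_average V E f \<le> root_average V E g"
  unfolding root_average_def by (intro divide_right_mono sum_mset_mono assms) simp

text \<open>The integrand is unbounded, so weak convergence is applied to its truncations \<open>min F m\<close>.\<close>
theorem theorem4p7:
  fixes d :: nat and V :: "'a set" and E :: "'a \<Rightarrow> 'a \<Rightarrow> bool" and t :: real
  assumes "d \<ge> 1"
    and "fin_graph V E" and "V \<noteq> {}" and "regular d V E" and "bipartite V E"
    and "t \<ge> 0"
  shows "(\<integral>z. ln (1 + t * z\<^sup>2) / 2 \<partial>matching_measure V E)
           \<ge> (\<integral>z. ln (1 + t * z\<^sup>2) / 2 \<partial>rho_tree d)"
proof (cases "t = 0")
  case False
  \<comment> \<open>At \<open>t = 0\<close> both integrands vanish; for \<open>t > 0\<close> the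
    evaluation point of \<open>root_average_ln\<close> is available.\<close>
  then have t: "t > 0" using assms(6) by simp
  define F where "F z = ln (1 + t * z\<^sup>2) / 2" for z
  have pos: "1 + t * z\<^sup>2 > 0" for z using t by (simp add: add_pos_nonneg)
  have F0: "F z \<ge> 0" for z using t by (simp add: F_def)
  have contF: "continuous_on UNIV F"
    unfolding F_def by (intro continuous_intros) (use pos in \<open>auto simp: less_imp_neq[symmetric]\<close>)
  define I where "I = ln (matching_gen V E t) / real (card V)"
  have I0: "I \<ge> 0" using matching_gen_ge_1[OF fin_graph_finite[OF assms(2)] assms(6), of E] by (simp add: I_def)
  have lhs: "(\<integral>z. F z \<partial>matching_measure V E) = I"
    using integral_matching_measure_continuous[OF assms(2) contF] root_average_ln[OF assms(2) t]
    by (simp add: F_def[abs_def] I_def)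
  \<comment> \<open>The sequence that approaches \<open>rho_tree d\<close> is made of covers of the
    given graph, so it carries the inequality with it.\<close>
  obtain Vs :: "nat \<Rightarrow> nat set" and Es where G:
    "\<And>N. fin_graph (Vs N) (Es N) \<and> Vs N \<noteq> {} \<and> regular d (Vs N) (Es N) \<and> bipartite (Vs N) (Es N)
      \<and> girth_ge (Vs N) (Es N) N
      \<and> (\<forall>t\<ge>0. ln (matching_gen (Vs N) (Es N) t) / real (card (Vs N)) \<le> ln (matching_gen V E t) / real (card V))"
    using large_girth_cover[OF assms(2-5)] by metis
  have seq: "large_girth_seq d Vs Es"
    unfolding large_girth_seq_def
  proof (intro conjI allI)
    fix n
    show "eventually (\<lambda>i. girth_ge (Vs i) (Es i) n) sequentially"
      using G by (auto intro!: eventually_sequentiallyI[of n] intro: girth_ge_mono)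
  qed (use G in auto)
  interpret T: real_distribution "rho_tree d" by (rule rho_tree_limit(1)[OF assms(1) seq])
  have trunc: "(\<integral>z. min (F z) (real m) \<partial>rho_tree d) \<le> I" for m
  proof (rule LIMSEQ_le_const2)
    have c: "continuous_on UNIV (\<lambda>z. min (F z) (real m))" using contF by (intro continuous_intros)
    have "bounded_continuous_fun (\<lambda>z. min (F z) (real m))"
      unfolding bounded_continuous_fun_def bounded_iff
      using c F0 by (auto intro!: exI[of _ "real m"] simp: min_def)
    then show "(\<lambda>i. \<integral>z. min (F z) (real m) \<partial>matching_measure (Vs i) (Es i)) \<longlonglongrightarrow> (\<integral>z. min (F z) (real m) \<partial>rho_tree d)"
      using rho_tree_limit(2)[OF assms(1) seq] by (simp add: weak_converges_def)
    have "(\<integral>z. min (F z) (real m) \<partial>matching_measure (Vs i) (Es i)) \<le> I" for i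
    proof -
      have "(\<integral>z. min (F z) (real m) \<partial>matching_measure (Vs i) (Es i)) = root_average (Vs i) (Es i) (\<lambda>z. min (F z) (real m))"
        using G by (intro integral_matching_measure_continuous c) auto
      also have "\<dots> \<le> root_average (Vs i) (Es i) F" by (rule root_average_mono) simp
      also have "\<dots> = ln (matching_gen (Vs i) (Es i) t) / real (card (Vs i))"
        using root_average_ln[of "Vs i" "Es i" t] G t by (simp add: F_def[abs_def])
      also have "\<dots> \<le> I" using G t by (simp add: I_def)
      finally show ?thesis .
    qed
    then show "\<exists>N. \<forall>n\<ge>N. (\<integral>z. min (F z) (real m) \<partial>matching_measure (Vs n) (Es n)) \<le> I" by blast
  qed
  have "(\<integral>z. F z \<partial>rho_tree d) \<le> I"
  proof (cases "integrable (rho_tree d) F")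
    case True
    have [measurable]: "F \<in> borel_measurable borel" by (rule borel_measurable_continuous_onI[OF contF])
    have "(\<lambda>m. \<integral>z. min (F z) (real m) \<partial>rho_tree d) \<longlonglongrightarrow> (\<integral>z. F z \<partial>rho_tree d)"
    proof (rule integral_dominated_convergence[where w = F])
      show "AE z in rho_tree d. (\<lambda>m. min (F z) (real m)) \<longlonglongrightarrow> F z"
      proof (rule AE_I2)
        fix z
        obtain n where "F z \<le> real n" using real_arch_simple by blast
        then have "eventually (\<lambda>m. min (F z) (real m) = F z) sequentially"
          by (intro eventually_sequentiallyI[of n]) (simp add: min_absorb1)
        then show "(\<lambda>m. min (F z) (real m)) \<longlonglongrightarrow> F z" by (rule tendsto_eventually)
      qed
    qed (use True F0 in auto)
    then show ?thesis by (rule LIMSEQ_le_const2) (use trunc in blast)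
  next
    \<comment> \<open>The integral of a non-integrable function is 0 by convention, and
      \<open>I\<close> is nonnegative.\<close>
    case False
    then show ?thesis using I0 by (simp add: not_integrable_integral_eq)
  qed
  then show ?thesis using lhs by (simp add: F_def)
qed simp

end
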